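(* Let $d\ge 0$ and $0\le k\le d$ be integers, let $V_1,\ldots,V_{d+1}$ be pairwise disjoint finite sets, and put $V=V_1\sqcup\cdots\sqcup V_{d+1}$. Let $T\subseteq V_1*\cdots*V_{k+1}$ be a $\mathbb Z_2$-spanning $k$-tree (of the complex $X=V_1*\cdots*V_{k+1}$). If $A:|\Delta_V|\to\mathbb R^d$ is a colorful Carathéodory map, then there exists a face $\sigma\in T*V_{k+2}*\cdots*V_{d+1}$ such that $0\in A(\sigma)$.
   Context: An abstract simplicial complex is a family of finite subsets (faces) of a ground set that is closed under taking subsets and contains $\varnothing$; the dimension of a face is its cardinality minus $1$; a facet is an inclusion-maximal face. For a finite set $V$, $\Delta_V:=2^V$ is the full simplex on $V$. For complexes $K,L$ on disjoint vertex sets the join is $K*L=\{\sigma\cup\tau:\sigma\in K,\ \tau\in L\}$. When a finite set appears in a join, it is regarded as the $0$-dimensional complex whose nonempty faces are its one-point subsets; thus $V_1*\cdots*V_m$ is the complex of all subsets of $V_1\sqcup\cdots\sqcup V_m$ containing at most one element of each $V_i$. For a complex $K$ on a finite vertex set $V$, each vertex $v$ is placed at the standard basis vector $e_v\in\mathbb R^V$; for $\sigma\in K$, $|\sigma|=\operatorname{conv}\{e_v:v\in\sigma\}$, $|\sigma|^\circ$ is its relative interior (the open simplex), and $|K|=\bigsqcup_{\sigma\in K}|\sigma|^\circ$. A map $A:|K|\to\mathbb R^d$ is affine if it is the affine extension over each face of its values on the vertices. For $\sigma\in K$ one writes $A(\sigma):=A(|\sigma|^\circ)$. An affine map $A:|\Delta_V|\to\mathbb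 R^d$, where $V=V_1\sqcup\cdots\sqcup V_{d+1}$, is a colorful Carathéodory map if $0\in A(V_i)$ for every $i=1,\dots,d+1$; here $V_i$ is regarded as a face of $\Delta_V$, so $A(V_i)=A(|V_i|^\circ)$. Let $X$ be a finite $k$-dimensional simplicial complex. A subcomplex $T\subseteq X$ is a $\mathbb Z_2$-spanning $k$-tree if $T$ contains all faces of $X$ of dimension at most $k-1$ and: (1) $\widetilde H_k(T;\mathbb Z_2)=0$; (2) $\widetilde H_k(T\cup\{\sigma\};\mathbb Z_2)\neq 0$ for every facet $\sigma$ of $X$ that does not belong to $T$. Here $\widetilde H_*$ denotes reduced simplicial homology. *)

theory Defs
  imports
    "HOL-Analysis.Analysis"
    "HOL-Analysis.Finite_Function_Topology"
    "HOL-Algebra.Elementary_Groups"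
    "HOL-Library.Z2"
begin

section \<open>Abstract simplicial complexes and joins\<close>

definition simplicial_complex :: "'a set set \<Rightarrow> bool" where
  "simplicial_complex K \<longleftrightarrow>
     {} \<in> K \<and> (\<forall>\<sigma>\<in>K. finite \<sigma>) \<and> (\<forall>\<sigma>\<in>K. \<forall>\<tau>. \<tau> \<subseteq> \<sigma> \<longrightarrow> \<tau> \<in> K)"

text \<open>The dimension is an integer, so that the empty face has dimension \<open>-1\<close>.\<close>

definition face_dim :: "'a set \<Rightarrow> int" where
  "face_dim \<sigma> = int (card \<sigma>) - 1"

definition complex_of_dim :: "int \<Rightarrow> 'a set set \<Rightarrow> bool" where
  "complex_of_dim p K \<longleftrightarrow> (\<exists>\<sigma>\<in>K. face_dim \<sigma> = p) \<and> (\<forall>\<sigma>\<in>K. face_dim \<sigma> \<le> p)"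

definition facet :: "'a set set \<Rightarrow> 'a set \<Rightarrow> bool" where
  "facet K \<sigma> \<longleftrightarrow> \<sigma> \<in> K \<and> (\<forall>\<tau>\<in>K. \<sigma> \<subseteq> \<tau> \<longrightarrow> \<tau> = \<sigma>)"

definition complex_join :: "'a set set \<Rightarrow> 'a set set \<Rightarrow> 'a set set" where
  "complex_join K L = {\<sigma> \<union> \<tau> | \<sigma> \<tau>. \<sigma> \<in> K \<and> \<tau> \<in> L}"

definition discrete_complex :: "'a set \<Rightarrow> 'a set set" where
  "discrete_complex S = insert {} ((\<lambda>v. {v}) ` S)"

text \<open>The join \<open>V m * \<dots> * V n\<close> of finite sets viewed as \<open>0\<close>-dimensional complexes. If \<open>n < m\<close>
  this is the empty join \<open>{{}}\<close>, the unit of \<^const>\<open>complex_join\<close>.\<close>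

definition color_join :: "(nat \<Rightarrow> 'a set) \<Rightarrow> nat \<Rightarrow> nat \<Rightarrow> 'a set set" where
  "color_join V m n = foldr (\<lambda>i. complex_join (discrete_complex (V i))) [m..<Suc n] {{}}"


section \<open>Reduced simplicial homology with coefficients in \<open>\<int>\<^sub>2\<close>\<close>

definition chain_group_Z2 :: "'a set set \<Rightarrow> int \<Rightarrow> ('a set \<Rightarrow>\<^sub>0 bit) monoid" where
  "chain_group_Z2 K p =
     \<lparr>carrier = {c. Poly_Mapping.keys c \<subseteq> {\<sigma>\<in>K. face_dim \<sigma> = p}},
      monoid.mult = (+), one = 0\<rparr>"

text \<open>On \<open>0\<close>-chains this is the augmentation, with values in the multiples of the empty face.\<close>

definition boundary_Z2 :: "('a set \<Rightarrow>\<^sub>0 bit) \<Rightarrow> ('a set \<Rightarrow>\<^sub>0 bit)" where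
  "boundary_Z2 c =
     (\<Sum>\<sigma>\<in>Poly_Mapping.keys c. \<Sum>v\<in>\<sigma>.
        Poly_Mapping.single (\<sigma> - {v}) (Poly_Mapping.lookup c \<sigma>))"

definition cycles_Z2 :: "'a set set \<Rightarrow> int \<Rightarrow> ('a set \<Rightarrow>\<^sub>0 bit) set" where
  "cycles_Z2 K p = {c \<in> carrier (chain_group_Z2 K p). boundary_Z2 c = 0}"

definition boundaries_Z2 :: "'a set set \<Rightarrow> int \<Rightarrow> ('a set \<Rightarrow>\<^sub>0 bit) set" where
  "boundaries_Z2 K p = boundary_Z2 ` carrier (chain_group_Z2 K (p + 1))"

definition reduced_homology_Z2 :: "'a set set \<Rightarrow> int \<Rightarrow> ('a set \<Rightarrow>\<^sub>0 bit) set monoid" where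
  "reduced_homology_Z2 K p =
     (chain_group_Z2 K p)\<lparr>carrier := cycles_Z2 K p\<rparr> Mod boundaries_Z2 K p"

definition spanning_tree_Z2 :: "nat \<Rightarrow> 'a set set \<Rightarrow> 'a set set \<Rightarrow> bool" where
  "spanning_tree_Z2 k X T \<longleftrightarrow>
     simplicial_complex X \<and> finite X \<and> complex_of_dim (int k) X \<and>
     simplicial_complex T \<and> T \<subseteq> X \<and>
     (\<forall>\<sigma>\<in>X. face_dim \<sigma> \<le> int k - 1 \<longrightarrow> \<sigma> \<in> T) \<and>
     trivial_group (reduced_homology_Z2 T (int k)) \<and>
     (\<forall>\<sigma>. facet X \<sigma> \<and> \<sigma> \<notin> T \<longrightarrow>
        \<not> trivial_group (reduced_homology_Z2 (T \<union> {\<sigma>}) (int k)))"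


section \<open>Geometric realization and affine maps\<close>

text \<open>For finite \<open>S\<close> this is \<open>\<real>\<^sup>S\<close>; its standard basis vectors are \<open>Poly_Mapping.single s 1\<close>.
  In particular \<open>coord_space {..<d}\<close> is \<open>\<real>\<^sup>d\<close>, including \<open>d = 0\<close>.\<close>

definition coord_space :: "'a set \<Rightarrow> ('a \<Rightarrow>\<^sub>0 real) set" where
  "coord_space S = {x. Poly_Mapping.keys x \<subseteq> S}"

definition basis_vec :: "'a \<Rightarrow> 'a \<Rightarrow>\<^sub>0 real" where
  "basis_vec v = Poly_Mapping.single v 1"

definition simplex_hull :: "'a set \<Rightarrow> ('a \<Rightarrow>\<^sub>0 real) set" where
  "simplex_hull \<sigma> = convex hull (basis_vec ` \<sigma>)"

definition open_simplex :: "'a set \<Rightarrow> ('a \<Rightarrow>\<^sub>0 real) set" where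
  "open_simplex \<sigma> = rel_interior (simplex_hull \<sigma>)"

definition realization :: "'a set set \<Rightarrow> ('a \<Rightarrow>\<^sub>0 real) set" where
  "realization K = (\<Union>\<sigma>\<in>K. open_simplex \<sigma>)"

definition affine_map :: "'a set set \<Rightarrow> nat \<Rightarrow> (('a \<Rightarrow>\<^sub>0 real) \<Rightarrow> (nat \<Rightarrow>\<^sub>0 real)) \<Rightarrow> bool" where
  "affine_map K d A \<longleftrightarrow>
     A \<in> realization K \<rightarrow> coord_space {..<d} \<and>
     (\<forall>\<sigma>\<in>K. \<forall>t. (\<forall>v\<in>\<sigma>. 0 \<le> t v) \<and> sum t \<sigma> = 1 \<longrightarrow>
        A (\<Sum>v\<in>\<sigma>. t v *\<^sub>R basis_vec v) = (\<Sum>v\<in>\<sigma>. t v *\<^sub>R A (basis_vec v)))"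

definition face_image :: "(('a \<Rightarrow>\<^sub>0 real) \<Rightarrow> (nat \<Rightarrow>\<^sub>0 real)) \<Rightarrow> 'a set \<Rightarrow> (nat \<Rightarrow>\<^sub>0 real) set" where
  "face_image A \<sigma> = A ` open_simplex \<sigma>"

definition colorful_caratheodory_map ::
  "nat \<Rightarrow> (nat \<Rightarrow> 'a set) \<Rightarrow> (('a \<Rightarrow>\<^sub>0 real) \<Rightarrow> (nat \<Rightarrow>\<^sub>0 real)) \<Rightarrow> bool" where
  "colorful_caratheodory_map d V A \<longleftrightarrow>
     affine_map (Pow (\<Union>i\<in>{1..d+1}. V i)) d A \<and>
     (\<forall>i\<in>{1..d+1}. 0 \<in> face_image A (V i))"

end

theory Submission
  imports Defs
begin

text \<open>
  Suppose that no face of \<open>Q = T * V (k+2) * \<dots> * V (d+1)\<close> captures the origin, so that every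
  \<open>\<tau>\<close> in \<open>Q\<close> lies in an open half-space \<open>{x. u \<bullet> x > 0}\<close>. For a set of directions \<open>U\<close>
  let \<open>Q(U)\<close> consist of the faces that have such a \<open>u\<close> in \<open>U\<close>. If every colour class meets every
  open half-space, then \<open>Q(U)\<close> is acyclic up to dimension \<open>d - 2\<close> for convex \<open>U\<close> not containing
  \<open>0\<close>: cutting \<open>U\<close> along the hyperplanes orthogonal to the vertices reduces this, by
  Mayer--Vietoris, to a single direction \<open>u\<close>, where \<open>Q({u})\<close> is a join of nonempty pieces. Cutting
  \<open>\<real>\<^sup>d\<close> into the half-spaces of positive and negative last coordinate, acyclicity of
  \<open>Q = Q(\<real>\<^sup>d)\<close> in dimension \<open>d - 1\<close> would descend to \<open>Q(\<real>\<^sup>r)\<close> in dimension \<open>r - 1\<close>, and finally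
  to \<open>Q({0}) = {{}}\<close> in dimension \<open>-1\<close>, which is absurd. But \<open>Q\<close> is acyclic in dimension \<open>d - 1\<close>,
  because a spanning tree is acyclic in dimension \<open>k - 1\<close>.

  A colour class that captures the origin only in a lower-dimensional hull misses some open
  half-spaces. Therefore each point is first replaced by a small cluster around it, and \<open>T\<close> by its
  preimage, which is again acyclic in dimension \<open>k - 1\<close>.
\<close>


section \<open>Chains modulo two\<close>

type_synonym 'a chain = "'a set \<Rightarrow>\<^sub>0 bit"

abbreviation keys :: "('a \<Rightarrow>\<^sub>0 'b::zero) \<Rightarrow> 'a set" where
  "keys \<equiv> Poly_Mapping.keys"

abbreviation simplex_chain :: "'a set \<Rightarrow> 'a chain" where
  "simplex_chain \<sigma> \<equiv> Poly_Mapping.single \<sigma> 1"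

text \<open>Linear extension of a map defined on faces. No coefficients appear, since over
  \<open>bit\<close> every face in the support has coefficient 1.\<close>

definition chain_extend :: "('a set \<Rightarrow> 'b chain) \<Rightarrow> 'a chain \<Rightarrow> 'b chain" where
  "chain_extend f c = (\<Sum>\<sigma>\<in>keys c. f \<sigma>)"

lemma bit_add_self: "(b::bit) + b = 0"
  by (cases b) simp_all

lemma chain_add_self [simp]: "(c::'a chain) + c = 0"
  by (rule poly_mapping_eqI) (simp only: lookup_add bit_add_self lookup_zero)

lemma chain_add_self_left [simp]: "(c::'a chain) + (c + e) = e"
  by (simp flip: add.assoc)

lemma chain_add_eq_0_iff: "(c::'a chain) + e = 0 \<longleftrightarrow> c = e"
  by (metis add.right_neutral chain_add_self chain_add_self_left)

lemma lookup_key_bit: "\<sigma> \<in> keys (c::'a chain) \<Longrightarrow> Poly_Mapping.lookup c \<sigma> = 1"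
  by (simp add: in_keys_iff)

lemma chain_extend_add [simp]: "chain_extend f (c + e) = chain_extend f c + chain_extend f e"
proof -
  \<comment> \<open>\<open>g\<close> makes the coefficient explicit, so that additivity is checked
    one face at a time: a face common to \<open>c\<close> and \<open>e\<close> contributes
    \<open>f \<sigma>\<close> twice, which is zero.\<close>
  define g where "g \<sigma> (b::bit) = (if b = 1 then f \<sigma> else 0)" for \<sigma> b
  have *: "chain_extend f x = (\<Sum>\<sigma>\<in>keys x. g \<sigma> (Poly_Mapping.lookup x \<sigma>))" for x
    unfolding chain_extend_def g_def by (intro sum.cong) (auto simp: lookup_key_bit)
  have "g \<sigma> (a + b) = g \<sigma> a + g \<sigma> b" for \<sigma> a b
    by (cases a; cases b) (simp_all add: g_def)
  moreover have "g \<sigma> 0 = 0" for \<sigma> by (simp add: g_def)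
  ultimately show ?thesis unfolding * by (intro setsum_keys_plus_distrib) auto
qed

lemma chain_extend_0 [simp]: "chain_extend f 0 = 0"
  by (simp add: chain_extend_def)

lemma chain_extend_single [simp]: "chain_extend f (simplex_chain \<sigma>) = f \<sigma>"
  by (simp add: chain_extend_def)

lemma chain_extend_sum: "chain_extend f (sum g I) = (\<Sum>i\<in>I. chain_extend f (g i))"
  by (induction I rule: infinite_finite_induct) simp_all

lemma chain_eq_sum: "(c::'a chain) = (\<Sum>\<sigma>\<in>keys c. simplex_chain \<sigma>)"
proof (rule poly_mapping_eqI)
  fix \<tau>
  show "Poly_Mapping.lookup c \<tau> = Poly_Mapping.lookup (\<Sum>\<sigma>\<in>keys c. simplex_chain \<sigma>) \<tau>"
  proof (cases "\<tau> \<in> keys c")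
    case True
    then have "(\<Sum>\<sigma>\<in>keys c. Poly_Mapping.lookup (simplex_chain \<sigma>) \<tau>)
      = (\<Sum>\<sigma>\<in>{\<tau>}. Poly_Mapping.lookup (simplex_chain \<sigma>) \<tau>)"
      by (intro sum.mono_neutral_right) (auto simp: lookup_single)
    then show ?thesis using True by (simp add: lookup_sum lookup_key_bit)
  next
    case False
    then have "(\<Sum>\<sigma>\<in>keys c. Poly_Mapping.lookup (simplex_chain \<sigma>) \<tau>) = 0"
      by (intro sum.neutral) (auto simp: lookup_single when_def)
    then show ?thesis using False by (simp add: lookup_sum in_keys_iff)
  qed
qed

text \<open>Meant for properties compatible with addition: the step does not ask whether the new
  face cancels one in \<open>c\<close>.\<close>

lemma chain_induct [consumes 1, case_names zero add]:
  assumes "keys (c::'a chain) \<subseteq> S"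
    and "P 0" and "\<And>\<sigma> c. \<sigma> \<in> S \<Longrightarrow> P c \<Longrightarrow> P (simplex_chain \<sigma> + c)"
  shows "P c"
proof -
  have "P (\<Sum>\<sigma>\<in>F. simplex_chain \<sigma>)" if "finite F" "F \<subseteq> S" for F
    using that by (induction F rule: finite_induct) (auto intro: assms)
  then show ?thesis using assms(1) chain_eq_sum[of c] by (metis finite_keys)
qed

definition simplex_boundary :: "'a set \<Rightarrow> 'a chain" where
  "simplex_boundary \<sigma> = (\<Sum>v\<in>\<sigma>. simplex_chain (\<sigma> - {v}))"

lemma boundary_eq_extend: "boundary_Z2 c = chain_extend simplex_boundary c"
  unfolding boundary_Z2_def chain_extend_def simplex_boundary_def
  by (intro sum.cong) (auto simp: lookup_key_bit)

lemma boundary_add [simp]: "boundary_Z2 (c + e) = boundary_Z2 c + boundary_Z2 e"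
  by (simp add: boundary_eq_extend)

lemma boundary_0 [simp]: "boundary_Z2 0 = 0"
  by (simp add: boundary_eq_extend)

lemma boundary_sum: "boundary_Z2 (sum g I) = (\<Sum>i\<in>I. boundary_Z2 (g i))"
  by (simp add: boundary_eq_extend chain_extend_sum)

lemma boundary_single: "boundary_Z2 (simplex_chain \<sigma>) = simplex_boundary \<sigma>"
  by (simp add: boundary_eq_extend)

lemma boundary_boundary_single:
  assumes "finite \<sigma>"
  shows "boundary_Z2 (simplex_boundary \<sigma>) = 0"
proof -
  have "boundary_Z2 (simplex_boundary \<sigma>)
      = (\<Sum>v\<in>\<sigma>. \<Sum>w\<in>\<sigma> - {v}. simplex_chain (\<sigma> - {v, w}))"
    unfolding simplex_boundary_def boundary_sum boundary_single
    by (intro sum.cong refl arg_cong[of _ _ simplex_chain]) blast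
  \<comment> \<open>The face left after removing two vertices does not depend on their order.
    Padding the diagonal with 0 exposes a sum over a symmetric array.\<close>
  also have "\<dots> = (\<Sum>v\<in>\<sigma>. \<Sum>w\<in>\<sigma>. if w = v then 0 else simplex_chain (\<sigma> - {v, w}))"
    using assms by (intro sum.cong refl sum.mono_neutral_cong_left) auto
  finally have eq: "boundary_Z2 (simplex_boundary \<sigma>)
    = (\<Sum>v\<in>\<sigma>. \<Sum>w\<in>\<sigma>. if w = v then 0 else simplex_chain (\<sigma> - {v, w}))" .
  \<comment> \<open>Peeling off one element \<open>x\<close>, its row and its column are equal and
    cancel mod 2.\<close>
  have "(\<Sum>v\<in>\<sigma>. \<Sum>w\<in>\<sigma>. g v w) = 0"
    if "\<And>v w. g v w = g w v" "\<And>v. g v v = 0" for g :: "'a \<Rightarrow> 'a \<Rightarrow> 'a chain"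
    using assms
  proof (induction \<sigma> rule: finite_induct)
    case (insert x F)
    have "(\<Sum>v\<in>F. g v x) = (\<Sum>w\<in>F. g x w)" using that by simp
    then show ?case using insert by (simp add: that sum.distrib)
  qed simp
  then show ?thesis unfolding eq by (auto simp: insert_commute)
qed

section \<open>Acyclic complexes\<close>

definition chain_space :: "'a set set \<Rightarrow> int \<Rightarrow> 'a chain set" where
  "chain_space K p = {c. keys c \<subseteq> {\<sigma>\<in>K. face_dim \<sigma> = p}}"

text \<open>Vanishing of reduced homology in degree \<open>p\<close>, put elementwise. Degrees are
  integers, so degree -1 is included; for a complex it says there that the empty face bounds, that
  is, that some vertex exists.\<close>

definition acyclic_Z2 :: "int \<Rightarrow> 'a set set \<Rightarrow> bool" where
  "acyclic_Z2 p K \<longleftrightarrow> (\<forall>z\<in>chain_space K p. boundary_Z2 z = 0 \<longrightarrow> (\<exists>c\<in>chain_space K (p + 1). boundary_Z2 c = z))"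

lemma chains_0 [simp]: "0 \<in> chain_space K p"
  by (simp add: chain_space_def)

lemma chains_add: "c \<in> chain_space K p \<Longrightarrow> e \<in> chain_space K p \<Longrightarrow> c + e \<in> chain_space K p"
  using keys_add[of c e] by (auto simp: chain_space_def)

lemma chains_sum: "(\<And>i. i \<in> I \<Longrightarrow> g i \<in> chain_space K p) \<Longrightarrow> sum g I \<in> chain_space K p"
  by (induction I rule: infinite_finite_induct) (auto intro: chains_add)

lemma chains_mono: "K \<subseteq> L \<Longrightarrow> chain_space K p \<subseteq> chain_space L p"
  by (auto simp: chain_space_def)

lemma chains_Int: "chain_space (K \<inter> L) p = chain_space K p \<inter> chain_space L p"
  by (auto simp: chain_space_def)

lemma chains_single: "\<sigma> \<in> K \<Longrightarrow> face_dim \<sigma> = p \<Longrightarrow> simplex_chain \<sigma> \<in> chain_space K p"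
  by (simp add: chain_space_def)

lemma chain_space_trivial:
  "c \<in> chain_space K p \<Longrightarrow> (\<And>\<sigma>. \<sigma> \<in> K \<Longrightarrow> face_dim \<sigma> \<noteq> p) \<Longrightarrow> c = 0"
  unfolding chain_space_def by (auto simp flip: keys_eq_empty)

lemma chains_induct [consumes 1, case_names zero add]:
  assumes "c \<in> chain_space K p"
    and "P 0" and "\<And>\<sigma> c. \<sigma> \<in> K \<Longrightarrow> face_dim \<sigma> = p \<Longrightarrow> P c \<Longrightarrow> P (simplex_chain \<sigma> + c)"
  shows "P c"
  using assms(1) unfolding chain_space_def mem_Collect_eq
  by (induction rule: chain_induct) (auto intro: assms)

lemma simplicial_complexD:
  assumes "simplicial_complex K"
  shows "{} \<in> K" "\<sigma> \<in> K \<Longrightarrow> finite \<sigma>" "\<sigma> \<in> K \<Longrightarrow> \<tau> \<subseteq> \<sigma> \<Longrightarrow> \<tau> \<in> K"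
  using assms unfolding simplicial_complex_def by blast+

lemma simplicial_complex_preimage:
  assumes "simplicial_complex K" "simplicial_complex T"
  shows "simplicial_complex {\<sigma> \<in> K. g ` \<sigma> \<in> T}"
  unfolding simplicial_complex_def
proof (intro conjI ballI allI impI)
  fix \<sigma> \<tau> assume "\<sigma> \<in> {\<sigma> \<in> K. g ` \<sigma> \<in> T}" "\<tau> \<subseteq> \<sigma>"
  then show "\<tau> \<in> {\<sigma> \<in> K. g ` \<sigma> \<in> T}"
    using simplicial_complexD(3)[OF assms(1), of \<sigma> \<tau>]
      simplicial_complexD(3)[OF assms(2), of "g ` \<sigma>" "g ` \<tau>"] image_mono[of \<tau> \<sigma> g] by simp
qed (use simplicial_complexD[OF assms(1)] simplicial_complexD(1)[OF assms(2)] in auto)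

lemma face_dim_remove: "finite \<sigma> \<Longrightarrow> v \<in> \<sigma> \<Longrightarrow> face_dim (\<sigma> - {v}) = face_dim \<sigma> - 1"
  using card.remove[of \<sigma> v] unfolding face_dim_def by linarith

lemma face_dim_insert: "finite \<sigma> \<Longrightarrow> v \<notin> \<sigma> \<Longrightarrow> face_dim (insert v \<sigma>) = face_dim \<sigma> + 1"
  by (simp add: face_dim_def)

lemma simplex_boundary_chains:
  assumes "simplicial_complex K" "\<sigma> \<in> K"
  shows "simplex_boundary \<sigma> \<in> chain_space K (face_dim \<sigma> - 1)"
  unfolding simplex_boundary_def
  by (intro chains_sum chains_single face_dim_remove)
    (use simplicial_complexD(2,3)[OF assms] in auto)

lemma boundary_chains:
  assumes "simplicial_complex K" "c \<in> chain_space K p"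
  shows "boundary_Z2 c \<in> chain_space K (p - 1)"
  using assms(2)
  by (induction rule: chains_induct)
    (use simplex_boundary_chains[OF assms(1)] in \<open>auto simp: boundary_single intro!: chains_add\<close>)

lemma boundary_boundary:
  assumes "simplicial_complex K" "c \<in> chain_space K p"
  shows "boundary_Z2 (boundary_Z2 c) = 0"
  using assms(2)
  by (induction rule: chains_induct)
    (use simplicial_complexD(2)[OF assms(1)] in \<open>auto simp: boundary_single boundary_boundary_single\<close>)

section \<open>Mayer-Vietoris arguments on chains\<close>

lemma chains_Un_split:
  assumes "c \<in> chain_space (K \<union> L) p"
  obtains a b where "a \<in> chain_space K p" "b \<in> chain_space L p" "c = a + b"
proof -
  have "\<exists>a\<in>chain_space K p. \<exists>b\<in>chain_space L p. c = a + b"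
    using assms
  proof (induction rule: chains_induct)
    case zero
    show ?case by (intro bexI[of _ 0]) auto
  next
    case (add \<sigma> c)
    then obtain a b where ab: "a \<in> chain_space K p" "b \<in> chain_space L p" "c = a + b" by auto
    show ?case
    proof (cases "\<sigma> \<in> K")
      case True
      then show ?thesis using ab add(2)
        by (intro bexI[of _ "simplex_chain \<sigma> + a"] bexI[of _ b])
          (auto simp: add.assoc intro!: chains_add chains_single)
    next
      case False
      then show ?thesis using ab add(1,2)
        by (intro bexI[of _ a] bexI[of _ "simplex_chain \<sigma> + b"])
          (auto simp: add.left_commute intro!: chains_add chains_single)
    qed
  qed
  then show ?thesis using that by blast
qed

text \<open>If a cycle splits as \<open>a + b\<close>, the common boundary of the parts is a cycle
  in the intersection. A filling \<open>e\<close> of it there turns both parts into cycles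
  \<open>a + e\<close> and \<open>b + e\<close>, and mod 2 the two copies of \<open>e\<close>
  cancel.\<close>

lemma acyclic_Un:
  assumes K: "simplicial_complex K" and L: "simplicial_complex L"
    and "acyclic_Z2 p K" "acyclic_Z2 p L" "acyclic_Z2 (p - 1) (K \<inter> L)"
  shows "acyclic_Z2 p (K \<union> L)"
  unfolding acyclic_Z2_def
proof (intro ballI impI)
  fix z assume z: "z \<in> chain_space (K \<union> L) p" "boundary_Z2 z = 0"
  obtain a b where ab: "a \<in> chain_space K p" "b \<in> chain_space L p" "z = a + b"
    using chains_Un_split[OF z(1)] .
  have eq: "boundary_Z2 a = boundary_Z2 b"
    using z(2) ab(3) by (simp add: chain_add_eq_0_iff)
  have "boundary_Z2 a \<in> chain_space (K \<inter> L) (p - 1)"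
    using boundary_chains[OF K ab(1)] boundary_chains[OF L ab(2)] eq by (simp add: chains_Int)
  then obtain e where e: "e \<in> chain_space (K \<inter> L) p" "boundary_Z2 e = boundary_Z2 a"
    using assms(5) boundary_boundary[OF K ab(1)] unfolding acyclic_Z2_def by force
  have "a + e \<in> chain_space K p" "b + e \<in> chain_space L p"
    using e(1) ab by (auto simp: chains_Int intro: chains_add)
  then obtain f g where "f \<in> chain_space K (p + 1)" "boundary_Z2 f = a + e"
      "g \<in> chain_space L (p + 1)" "boundary_Z2 g = b + e"
    using assms(3,4) e(2) eq unfolding acyclic_Z2_def by fastforce
  then show "\<exists>c\<in>chain_space (K \<union> L) (p + 1). boundary_Z2 c = z"
    using chains_mono[of K "K \<union> L"] chains_mono[of L "K \<union> L"] ab(3)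
    by (intro bexI[of _ "f + g"]) (auto simp: ac_simps intro!: chains_add)
qed

text \<open>Two fillings of \<open>z\<close>, one in \<open>K\<close> and one in \<open>L\<close>,
  form a cycle of the union. Splitting a filling of that cycle as \<open>f + g\<close> shows that
  \<open>a\<close> and \<open>b\<close> become equal after adding boundaries; the resulting chain
  lies in both complexes.\<close>

lemma acyclic_Int:
  assumes K: "simplicial_complex K" and L: "simplicial_complex L"
    and "acyclic_Z2 p (K \<union> L)" "acyclic_Z2 (p - 1) K" "acyclic_Z2 (p - 1) L"
  shows "acyclic_Z2 (p - 1) (K \<inter> L)"
  unfolding acyclic_Z2_def
proof (intro ballI impI)
  fix z assume z: "z \<in> chain_space (K \<inter> L) (p - 1)" "boundary_Z2 z = 0"
  then obtain a b where ab: "a \<in> chain_space K p" "boundary_Z2 a = z" "b \<in> chain_space L p" "boundary_Z2 b = z"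
    using assms(4,5) unfolding acyclic_Z2_def chains_Int by simp blast
  then have "a + b \<in> chain_space (K \<union> L) p" "boundary_Z2 (a + b) = 0"
    using chains_mono[of K "K \<union> L"] chains_mono[of L "K \<union> L"] by (auto intro!: chains_add)
  then obtain c where c: "c \<in> chain_space (K \<union> L) (p + 1)" "boundary_Z2 c = a + b"
    using assms(3) unfolding acyclic_Z2_def by blast
  obtain f g where fg: "f \<in> chain_space K (p + 1)" "g \<in> chain_space L (p + 1)" "c = f + g"
    using chains_Un_split[OF c(1)] .
  have "a + boundary_Z2 f + (b + boundary_Z2 g) = 0"
    using c(2) fg(3) by (simp add: ac_simps)
  then have eq: "a + boundary_Z2 f = b + boundary_Z2 g"
    by (simp only: chain_add_eq_0_iff)
  have "a + boundary_Z2 f \<in> chain_space K p" "b + boundary_Z2 g \<in> chain_space L p"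
    using ab fg boundary_chains[OF K fg(1)] boundary_chains[OF L fg(2)] by (auto intro!: chains_add)
  then have "a + boundary_Z2 f \<in> chain_space (K \<inter> L) p"
    using eq by (simp add: chains_Int)
  moreover have "boundary_Z2 (a + boundary_Z2 f) = z"
    using ab boundary_boundary[OF K fg(1)] by simp
  ultimately show "\<exists>c\<in>chain_space (K \<inter> L) (p - 1 + 1). boundary_Z2 c = z"
    by (metis diff_add_cancel)
qed

section \<open>Cones are acyclic\<close>

definition cone_chain :: "'a \<Rightarrow> 'a chain \<Rightarrow> 'a chain" where
  "cone_chain w = chain_extend (\<lambda>\<sigma>. if w \<in> \<sigma> then 0 else simplex_chain (insert w \<sigma>))"

text \<open>The cone is a chain homotopy from the identity to zero. Sending faces through
  \<open>w\<close> to 0 fits: if \<open>w\<close> lies in \<open>\<sigma>\<close>, only the face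
  \<open>\<sigma> - {w}\<close> survives in the coned boundary, and it returns
  \<open>\<sigma>\<close>.\<close>

lemma boundary_cone_single:
  assumes "finite \<sigma>"
  shows "boundary_Z2 (cone_chain w (simplex_chain \<sigma>))
    = simplex_chain \<sigma> + cone_chain w (simplex_boundary \<sigma>)"
proof (cases "w \<in> \<sigma>")
  case True
  have "cone_chain w (simplex_boundary \<sigma>)
    = (\<Sum>v\<in>\<sigma>. if v = w then simplex_chain \<sigma> else 0)"
    using True unfolding simplex_boundary_def cone_chain_def chain_extend_sum
    by (intro sum.cong) (auto simp: insert_absorb)
  then show ?thesis using True assms by (simp add: cone_chain_def)
next
  case False
  have "cone_chain w (simplex_boundary \<sigma>) = (\<Sum>v\<in>\<sigma>. simplex_chain (insert w \<sigma> - {v}))"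
    using False unfolding simplex_boundary_def cone_chain_def chain_extend_sum
    by (intro sum.cong) (auto simp: insert_Diff_if)
  then show ?thesis using False assms
    by (simp add: cone_chain_def boundary_single simplex_boundary_def)
qed

lemma boundary_cone:
  assumes "simplicial_complex K" "c \<in> chain_space K p"
  shows "boundary_Z2 (cone_chain w c) = c + cone_chain w (boundary_Z2 c)"
  using assms(2)
proof (induction rule: chains_induct)
  case (add \<sigma> c)
  have "cone_chain w (simplex_chain \<sigma> + c) = cone_chain w (simplex_chain \<sigma>) + cone_chain w c"
      "cone_chain w (simplex_boundary \<sigma> + boundary_Z2 c)
        = cone_chain w (simplex_boundary \<sigma>) + cone_chain w (boundary_Z2 c)"
    by (simp_all add: cone_chain_def)
  then show ?case
    using add boundary_cone_single[of \<sigma> w] simplicial_complexD(2)[OF assms(1) add(1)]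
    by (simp add: boundary_single ac_simps)
qed (simp add: cone_chain_def)

text \<open>By the cone formula, coning a cycle fills it.\<close>

lemma acyclic_cone:
  assumes K: "simplicial_complex K" and cone: "\<And>\<sigma>. \<sigma> \<in> K \<Longrightarrow> insert w \<sigma> \<in> K"
  shows "acyclic_Z2 p K"
  unfolding acyclic_Z2_def
proof (intro ballI impI)
  fix z assume z: "z \<in> chain_space K p" "boundary_Z2 z = 0"
  have "cone_chain w z \<in> chain_space K (p + 1)"
    using z(1)
  proof (induction rule: chains_induct)
    case (add \<sigma> c)
    then show ?case using cone simplicial_complexD(2)[OF K]
      by (auto simp: cone_chain_def face_dim_insert intro!: chains_add chains_single)
  qed (simp add: cone_chain_def)
  moreover have "boundary_Z2 (cone_chain w z) = z"
    using boundary_cone[OF K z(1)] z(2) by (simp add: cone_chain_def)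
  ultimately show "\<exists>c\<in>chain_space K (p + 1). boundary_Z2 c = z" by blast
qed

section \<open>Joins\<close>

lemma complex_join_assoc:
  "complex_join (complex_join K L) M = complex_join K (complex_join L M)"
  unfolding complex_join_def by (auto; metis sup_assoc)

lemma complex_join_unit [simp]: "complex_join {{}} K = K" "complex_join K {{}} = K"
  by (auto simp: complex_join_def)

lemma simplicial_complex_join:
  assumes K: "simplicial_complex K" and L: "simplicial_complex L"
  shows "simplicial_complex (complex_join K L)"
  unfolding simplicial_complex_def
proof (intro conjI ballI allI impI)
  show "{} \<in> complex_join K L"
    using simplicial_complexD(1)[OF K] simplicial_complexD(1)[OF L]
    unfolding complex_join_def by blast
next
  fix \<sigma> assume "\<sigma> \<in> complex_join K L"
  then show "finite \<sigma>"
    using simplicial_complexD(2)[OF K] simplicial_complexD(2)[OF L]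
    unfolding complex_join_def by auto
next
  fix \<sigma> \<tau> assume "\<sigma> \<in> complex_join K L" "\<tau> \<subseteq> \<sigma>"
  then obtain a b where ab: "a \<in> K" "b \<in> L" "\<tau> \<subseteq> a \<union> b" unfolding complex_join_def by auto
  then have "a \<inter> \<tau> \<in> K" "b \<inter> \<tau> \<in> L" "\<tau> = a \<inter> \<tau> \<union> b \<inter> \<tau>"
    using simplicial_complexD(3)[OF K] simplicial_complexD(3)[OF L] by auto
  then show "\<tau> \<in> complex_join K L" unfolding complex_join_def by blast
qed

lemma simplicial_complex_discrete: "simplicial_complex (discrete_complex D)"
  unfolding simplicial_complex_def discrete_complex_def by auto

lemma simplicial_complex_empty_face: "simplicial_complex {{}}"
  unfolding simplicial_complex_def by auto

lemma acyclic_join_point: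
  assumes "simplicial_complex K"
  shows "acyclic_Z2 p (complex_join K (discrete_complex {v}))"
proof (rule acyclic_cone[where w = v])
  show "simplicial_complex (complex_join K (discrete_complex {v}))"
    by (intro simplicial_complex_join assms simplicial_complex_discrete)
qed (auto simp: complex_join_def discrete_complex_def)

text \<open>Points of \<open>D\<close> are added one at a time. Each new point contributes a cone
  over \<open>K\<close>, which meets what is already there exactly in \<open>K\<close>; so
  acyclicity of \<open>K\<close> in degree \<open>p\<close> is what Mayer-Vietoris asks for in
  degree \<open>p + 1\<close>.\<close>

lemma acyclic_join_discrete:
  assumes K: "simplicial_complex K" and "acyclic_Z2 p K"
    and "finite D" "D \<noteq> {}" "D \<inter> \<Union>K = {}"
  shows "acyclic_Z2 (p + 1) (complex_join K (discrete_complex D))"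
  using assms(3-5)
proof (induction D rule: finite_ne_induct)
  case (singleton v)
  show ?case by (rule acyclic_join_point[OF K])
next
  case (insert v D)
  let ?D = "complex_join K (discrete_complex D)" and ?v = "complex_join K (discrete_complex {v})"
  have "acyclic_Z2 (p + 1) ?v" by (rule acyclic_join_point[OF K])
  moreover have "?D \<inter> ?v = K"
  proof
    show "?D \<inter> ?v \<subseteq> K"
    proof
      fix \<sigma> assume "\<sigma> \<in> ?D \<inter> ?v"
      then obtain a b a' b' where "a \<in> K" "b \<in> discrete_complex D" "a' \<in> K"
          "b' \<in> discrete_complex {v}" "\<sigma> = a \<union> b" "\<sigma> = a' \<union> b'"
        unfolding complex_join_def by blast
      then show "\<sigma> \<in> K" using insert(3,5) unfolding discrete_complex_def by auto
    qed
    show "K \<subseteq> ?D \<inter> ?v" unfolding complex_join_def discrete_complex_def by auto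
  qed
  moreover have "acyclic_Z2 (p + 1) ?D" using insert by auto
  moreover have "complex_join K (discrete_complex (insert v D)) = ?D \<union> ?v"
    unfolding complex_join_def discrete_complex_def by auto
  ultimately show ?case
    using acyclic_Un[of ?D ?v "p + 1"] \<open>acyclic_Z2 p K\<close>
    by (simp add: simplicial_complex_join K simplicial_complex_discrete)
qed

section \<open>Iterated joins of colour classes\<close>

definition list_join :: "('i \<Rightarrow> 'a set) \<Rightarrow> 'i list \<Rightarrow> 'a set set" where
  "list_join V is = foldr (\<lambda>i. complex_join (discrete_complex (V i))) is {{}}"

lemma list_join_simps [simp]:
  "list_join V [] = {{}}"
  "list_join V (i # is) = complex_join (discrete_complex (V i)) (list_join V is)"
  by (simp_all add: list_join_def)

lemma color_join_eq_list_join: "color_join V m n = list_join V [m..<Suc n]"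
  by (simp add: color_join_def list_join_def)

lemma simplicial_complex_list_join: "simplicial_complex (list_join V is)"
  by (induction "is")
    (simp_all add: simplicial_complex_empty_face simplicial_complex_join simplicial_complex_discrete)

text \<open>Disjointness of the colours makes the factor from \<open>V i\<close> recoverable as
  \<open>\<sigma> \<inter> V i\<close>, so the faces are the rainbow sets.\<close>

lemma mem_list_join_iff:
  assumes "distinct is" "disjoint_family_on V (set is)"
  shows "\<sigma> \<in> list_join V is \<longleftrightarrow>
    \<sigma> \<subseteq> (\<Union>i\<in>set is. V i) \<and> (\<forall>i\<in>set is. \<forall>x\<in>\<sigma> \<inter> V i. \<forall>y\<in>\<sigma> \<inter> V i. x = y)"
  using assms
proof (induction "is" arbitrary: \<sigma>)
  case (Cons i "is")
  have disj: "V i \<inter> V j = {}" if "j \<in> set is" for j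
    using Cons.prems that by (intro disjoint_family_onD[of V "set (i # is)"]) auto
  have IH: "\<sigma> \<in> list_join V is \<longleftrightarrow> \<sigma> \<subseteq> (\<Union>i\<in>set is. V i)
      \<and> (\<forall>i\<in>set is. \<forall>x\<in>\<sigma> \<inter> V i. \<forall>y\<in>\<sigma> \<inter> V i. x = y)" for \<sigma>
    using Cons by (simp add: disjoint_family_on_def)
  show ?case
  proof
    assume "\<sigma> \<in> list_join V (i # is)"
    then obtain a b where ab: "a \<in> discrete_complex (V i)" "b \<in> list_join V is" "\<sigma> = a \<union> b"
      by (auto simp: complex_join_def)
    have a: "a \<subseteq> V i" "\<forall>x\<in>a. \<forall>y\<in>a. x = y" using ab(1) by (auto simp: discrete_complex_def)
    have b: "b \<subseteq> (\<Union>i\<in>set is. V i)" "\<forall>i\<in>set is. \<forall>x\<in>b \<inter> V i. \<forall>y\<in>b \<inter> V i. x = y"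
      using ab(2) IH by auto
    have 1: "\<sigma> \<inter> V i = a" using ab(3) a(1) b(1) disj by blast
    have 2: "\<sigma> \<inter> V j = b \<inter> V j" if "j \<in> set is" for j using ab(3) a(1) disj[OF that] by blast
    have "\<sigma> \<subseteq> (\<Union>i\<in>set (i # is). V i)" using a(1) b(1) ab(3) by auto
    moreover have "\<forall>x\<in>\<sigma> \<inter> V i. \<forall>y\<in>\<sigma> \<inter> V i. x = y" unfolding 1 by (rule a(2))
    moreover have "\<forall>x\<in>\<sigma> \<inter> V j. \<forall>y\<in>\<sigma> \<inter> V j. x = y" if "j \<in> set is" for j
      unfolding 2[OF that] using b(2) that by blast
    ultimately show "\<sigma> \<subseteq> (\<Union>i\<in>set (i # is). V i)
        \<and> (\<forall>i\<in>set (i # is). \<forall>x\<in>\<sigma> \<inter> V i. \<forall>y\<in>\<sigma> \<inter> V i. x = y)"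
      unfolding list.set ball_simps by blast
  next
    assume r: "\<sigma> \<subseteq> (\<Union>i\<in>set (i # is). V i)
        \<and> (\<forall>i\<in>set (i # is). \<forall>x\<in>\<sigma> \<inter> V i. \<forall>y\<in>\<sigma> \<inter> V i. x = y)"
    have "\<sigma> \<inter> V i \<in> discrete_complex (V i)"
    proof (cases "\<sigma> \<inter> V i = {}")
      case False
      then obtain x where "x \<in> \<sigma> \<inter> V i" by blast
      with r have "\<sigma> \<inter> V i = {x}" by auto
      then show ?thesis using \<open>x \<in> \<sigma> \<inter> V i\<close> by (auto simp: discrete_complex_def)
    qed (simp add: discrete_complex_def)
    moreover have "\<sigma> - V i \<in> list_join V is" using r unfolding IH by auto
    moreover have "\<sigma> = \<sigma> \<inter> V i \<union> (\<sigma> - V i)" by blast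
    ultimately show "\<sigma> \<in> list_join V (i # is)"
      unfolding list_join_simps complex_join_def by blast
  qed
qed auto

text \<open>One colour class at a time is absorbed into \<open>K\<close>, each raising the acyclic
  degree by one.\<close>

lemma acyclic_join_list_join:
  assumes "simplicial_complex K" "acyclic_Z2 p K" "distinct is" "disjoint_family_on V (set is)"
    and "\<And>i. i \<in> set is \<Longrightarrow> finite (V i) \<and> V i \<noteq> {} \<and> V i \<inter> \<Union>K = {}"
  shows "acyclic_Z2 (p + int (length is)) (complex_join K (list_join V is))"
  using assms
proof (induction "is" arbitrary: K p)
  case (Cons i "is")
  let ?K = "complex_join K (discrete_complex (V i))"
  have disj: "V j \<inter> V i = {}" if "j \<in> set is" for j
    using Cons.prems that by (intro disjoint_family_onD[of V "set (i # is)"]) auto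
  have "\<Union>?K \<subseteq> \<Union>K \<union> V i" by (auto simp: complex_join_def discrete_complex_def)
  then have "V j \<inter> \<Union>?K = {}" if "j \<in> set is" for j
    using disj[OF that] Cons.prems(5)[of j] that by fastforce
  moreover have "simplicial_complex ?K"
    by (intro simplicial_complex_join Cons.prems simplicial_complex_discrete)
  moreover have "acyclic_Z2 (p + 1) ?K"
    using Cons.prems(5)[of i] by (intro acyclic_join_discrete Cons.prems) auto
  moreover have "disjoint_family_on V (set is)"
    using Cons.prems(4) by (rule disjoint_family_on_mono[rotated]) auto
  ultimately have "acyclic_Z2 (p + 1 + int (length is)) (complex_join ?K (list_join V is))"
    using Cons.prems(3,5) by (intro Cons.IH) auto
  then show ?case by (simp add: complex_join_assoc ac_simps)
qed simp

lemma acyclic_empty_face: "p \<noteq> -1 \<Longrightarrow> acyclic_Z2 p {{}}"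
proof -
  assume "p \<noteq> -1"
  then have "c = 0" if "c \<in> chain_space {{}} p" for c :: "'a chain"
    using chain_space_trivial[OF that] by (auto simp: face_dim_def)
  then show ?thesis unfolding acyclic_Z2_def by (intro ballI impI bexI[of _ 0]) auto
qed

text \<open>The empty face is a cycle of degree -1, and there is no vertex to bound it. This is the
  seed of the induction over coordinate subspaces in \<open>not_acyclic_visible\<close>.\<close>

lemma not_acyclic_empty_face: "\<not> acyclic_Z2 (-1) {{}::'a set}"
proof
  assume *: "acyclic_Z2 (-1) {{}::'a set}"
  have "simplex_chain {} \<in> chain_space {{}::'a set} (-1)"
      "boundary_Z2 (simplex_chain ({}::'a set)) = 0"
    by (simp_all add: chain_space_def face_dim_def boundary_single simplex_boundary_def)
  moreover have "c = 0" if "c \<in> chain_space {{}} 0" for c :: "'a chain"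
    using chain_space_trivial[OF that] by (auto simp: face_dim_def)
  ultimately have "simplex_chain ({}::'a set) = 0"
    using * unfolding acyclic_Z2_def by fastforce
  then have "keys (simplex_chain ({}::'a set)) = {}" by (simp only: keys_zero)
  then show False by simp
qed

lemma acyclic_list_join:
  assumes "distinct is" "disjoint_family_on V (set is)" "\<And>i. i \<in> set is \<Longrightarrow> finite (V i) \<and> V i \<noteq> {}"
    and "p < int (length is) - 1"
  shows "acyclic_Z2 p (list_join V is)"
  \<comment> \<open>The start is \<open>{{}}\<close> in degree \<open>p - length is\<close>, which
    is below -1 and therefore carries no chains.\<close>
  using acyclic_join_list_join[of "{{}}" "p - int (length is)" "is" V] assms
  by (simp add: simplicial_complex_empty_face acyclic_empty_face)

text \<open>Cycles of degree \<open>p\<close> and their fillings involve only faces of dimension at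
  most \<open>p + 1\<close>, so a complex may be exchanged for another with the same
  skeleton.\<close>

lemma acyclic_cong:
  assumes "\<And>\<sigma>. face_dim \<sigma> \<le> p + 1 \<Longrightarrow> \<sigma> \<in> K \<longleftrightarrow> \<sigma> \<in> L"
  shows "acyclic_Z2 p K \<longleftrightarrow> acyclic_Z2 p L"
proof -
  have "chain_space K q = chain_space L q" if "q \<le> p + 1" for q
    using assms that unfolding chain_space_def by (intro Collect_cong) auto
  then show ?thesis unfolding acyclic_Z2_def by simp
qed

lemma restrict_complex_join:
  "{\<tau> \<in> complex_join K L. \<tau> \<subseteq> S} = complex_join {\<sigma> \<in> K. \<sigma> \<subseteq> S} {\<tau> \<in> L. \<tau> \<subseteq> S}"
  unfolding complex_join_def by auto

lemma restrict_list_join: "{\<tau> \<in> list_join V is. \<tau> \<subseteq> S} = list_join (\<lambda>i. V i \<inter> S) is"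
proof (induction "is")
  case (Cons i "is")
  have "{\<tau> \<in> discrete_complex (V i). \<tau> \<subseteq> S} = discrete_complex (V i \<inter> S)"
    by (auto simp: discrete_complex_def)
  then show ?case by (simp add: restrict_complex_join Cons)
qed auto

section \<open>Faces in open half-spaces\<close>

text \<open>The subcomplex \<open>Q(U)\<close> of the overview, where \<open>f v u\<close> stands
  for the inner product of the point at \<open>v\<close> with \<open>u\<close>. The direction may
  vary with the face.\<close>

definition visible_faces :: "('b \<Rightarrow> 'u \<Rightarrow> real) \<Rightarrow> 'b set set \<Rightarrow> 'u set \<Rightarrow> 'b set set" where
  "visible_faces f Q U = {\<tau> \<in> Q. \<exists>u\<in>U. \<forall>v\<in>\<tau>. 0 < f v u}"

lemma simplicial_complex_visible:
  assumes "simplicial_complex Q" "U \<noteq> {}"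
  shows "simplicial_complex (visible_faces f Q U)"
  unfolding simplicial_complex_def visible_faces_def
  using simplicial_complexD[OF assms(1)] assms(2) by (auto 4 4)

text \<open>Positivity at finitely many vertices is an open condition along a ray. The bound
  \<open>t < 1\<close> keeps the new point on a segment when \<open>w\<close> is a difference of two
  points.\<close>

lemma positive_perturbation:
  fixes f :: "'b \<Rightarrow> 'u::real_vector \<Rightarrow> real"
  assumes "finite \<tau>" "\<And>v. linear (f v)" "\<forall>v\<in>\<tau>. 0 < f v u"
  obtains t where "0 < t" "t < 1" "\<forall>v\<in>\<tau>. 0 < f v (u + t *\<^sub>R w)"
proof -
  have "\<forall>\<^sub>F t in at_right 0. \<forall>v\<in>\<tau>. 0 < f v (u + t *\<^sub>R w)"
  proof (intro eventually_ball_finite assms ballI)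
    fix v assume "v \<in> \<tau>"
    have "((\<lambda>t. f v u + t * f v w) \<longlongrightarrow> f v u + 0 * f v w) (at_right 0)"
      by (intro tendsto_intros)
    then have "\<forall>\<^sub>F t in at_right 0. 0 < f v u + t * f v w"
      using assms(3) \<open>v \<in> \<tau>\<close> by (intro order_tendstoD(1)) auto
    then show "\<forall>\<^sub>F t in at_right 0. 0 < f v (u + t *\<^sub>R w)"
      by (simp add: linear_add[OF assms(2)] linear_scale[OF assms(2)])
  qed
  moreover have "\<forall>\<^sub>F t in at_right (0::real). 0 < t \<and> t < 1"
    by (auto simp: eventually_at_right_field intro: exI[of _ 1])
  ultimately have "\<forall>\<^sub>F t in at_right (0::real). (\<forall>v\<in>\<tau>. 0 < f v (u + t *\<^sub>R w)) \<and> 0 < t \<and> t < 1"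
    by (rule eventually_conj)
  then have "\<exists>t. (\<forall>v\<in>\<tau>. 0 < f v (u + t *\<^sub>R w)) \<and> 0 < t \<and> t < 1"
    by (rule eventually_happens'[rotated]) simp
  then show ?thesis using that by blast
qed

lemma convex_linear_preimage:
  fixes g :: "'u::real_vector \<Rightarrow> real"
  assumes "linear g" "convex U" "convex S"
  shows "convex {u \<in> U. g u \<in> S}"
proof -
  have "{u \<in> U. g u \<in> S} = U \<inter> g -` S" by auto
  then show ?thesis using assms by (simp add: convex_Int convex_linear_vimage)
qed

lemma convex_crossing:
  fixes g :: "'u::real_vector \<Rightarrow> real"
  assumes "linear g" "0 < g a" "g b \<le> 0"
  obtains t where "0 \<le> t" "t \<le> 1" "0 < t" "g ((1 - t) *\<^sub>R a + t *\<^sub>R b) = 0"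
proof
  let ?t = "g a / (g a - g b)"
  show "0 \<le> ?t" "?t \<le> 1" "0 < ?t" using assms by (auto simp: field_simps)
  have "g ((1 - ?t) *\<^sub>R a + ?t *\<^sub>R b) = (1 - ?t) * g a + ?t * g b"
    by (simp add: linear_add[OF assms(1)] linear_scale[OF assms(1)])
  also have "\<dots> = 0" using assms by (simp add: field_simps)
  finally show "g ((1 - ?t) *\<^sub>R a + ?t *\<^sub>R b) = 0" .
qed

lemma positive_segment:
  fixes g :: "'u::real_vector \<Rightarrow> real"
  assumes "linear g" "0 < g a" "0 < g b" "0 \<le> t" "t \<le> 1"
  shows "0 < g ((1 - t) *\<^sub>R a + t *\<^sub>R b)"
proof (cases "t = 0")
  case False
  then have "0 \<le> (1 - t) * g a" "0 < t * g b" using assms by auto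
  then show ?thesis by (simp add: linear_add[OF assms(1)] linear_scale[OF assms(1)])
qed (use assms in simp)

text \<open>Induction on the number of vertices whose hyperplane cuts \<open>U\<close>. When none
  does, positivity at a vertex is the same for all of \<open>U\<close>, and \<open>base\<close>
  applies at one direction. Otherwise a cutting hyperplane yields convex pieces \<open>P\<close>,
  \<open>M\<close> and the slice \<open>E\<close>, all cut by fewer vertices, and Mayer-Vietoris
  combines their complexes.\<close>

lemma acyclic_visible_convex:
  fixes f :: "'b \<Rightarrow> 'u::real_vector \<Rightarrow> real"
  assumes Q: "simplicial_complex Q" and W: "finite W" "\<Union>Q \<subseteq> W"
    and lin: "\<And>v. linear (f v)"
    and base: "\<And>u q. u \<in> U0 \<Longrightarrow> q \<le> m \<Longrightarrow> acyclic_Z2 q {\<tau> \<in> Q. \<forall>v\<in>\<tau>. 0 < f v u}"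
    and "convex U" "U \<noteq> {}" "U \<subseteq> U0" "q \<le> m"
  shows "acyclic_Z2 q (visible_faces f Q U)"
  using assms(6-9)
proof (induction "card {v \<in> W. (\<exists>u\<in>U. 0 < f v u) \<and> (\<exists>u\<in>U. f v u \<le> 0)}" arbitrary: U q
    rule: less_induct)
  case less
  define N where "N U = {v \<in> W. (\<exists>u\<in>U. 0 < f v u) \<and> (\<exists>u\<in>U. f v u \<le> 0)}" for U
  show ?case
  proof (cases "N U = {}")
    case True
    obtain u0 where u0: "u0 \<in> U" using less.prems by blast
    have "visible_faces f Q U = {\<tau> \<in> Q. \<forall>v\<in>\<tau>. 0 < f v u0}"
    proof
      show "visible_faces f Q U \<subseteq> {\<tau> \<in> Q. \<forall>v\<in>\<tau>. 0 < f v u0}"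
      proof
        fix \<tau> assume "\<tau> \<in> visible_faces f Q U"
        then obtain u where u: "\<tau> \<in> Q" "u \<in> U" "\<forall>v\<in>\<tau>. 0 < f v u"
          unfolding visible_faces_def by auto
        have "0 < f v u0" if "v \<in> \<tau>" for v
        proof (rule ccontr)
          assume "\<not> 0 < f v u0"
          then have "v \<in> N U" using that u u0 W unfolding N_def by force
          then show False using True by simp
        qed
        then show "\<tau> \<in> {\<tau> \<in> Q. \<forall>v\<in>\<tau>. 0 < f v u0}" using u by auto
      qed
    qed (use u0 in \<open>auto simp: visible_faces_def\<close>)
    then show ?thesis using base u0 less.prems by auto
  next
    case False
    then obtain x a b where x: "x \<in> W" "a \<in> U" "0 < f x a" "b \<in> U" "f x b \<le> 0"
      unfolding N_def by blast
    \<comment> \<open>\<open>P\<close> and \<open>M\<close> are disjoint, and \<open>E\<close> is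
      contained in \<open>M\<close>; it is the complexes of \<open>P\<close> and \<open>M\<close>
      that intersect exactly in the complex of \<open>E\<close>.\<close>
    define P M E where "P = {u \<in> U. f x u \<in> {0<..}}" and "M = {u \<in> U. f x u \<in> {..0}}"
      and "E = {u \<in> U. f x u \<in> {0}}"
    \<comment> \<open>Passing to a subset creates no new cut, and \<open>x\<close> no longer counts:
      on each piece \<open>f x\<close> is positive throughout or nonpositive throughout.\<close>
    have smaller: "card (N U') < card (N U)"
      if "U' \<subseteq> U" "x \<notin> N U'" for U'
    proof (rule psubset_card_mono)
      show "finite (N U)" using W unfolding N_def by simp
      have "x \<in> N U" using x unfolding N_def by blast
      then show "N U' \<subset> N U" using that unfolding N_def by blast
    qed
    obtain t where t: "0 \<le> t" "t \<le> 1" "f x ((1 - t) *\<^sub>R a + t *\<^sub>R b) = 0"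
      using convex_crossing[OF lin x(3,5)] .
    then have "(1 - t) *\<^sub>R a + t *\<^sub>R b \<in> E"
      unfolding E_def using \<open>convex U\<close> x by (auto intro!: convexD)
    then have ne: "P \<noteq> {}" "M \<noteq> {}" "E \<noteq> {}" using x unfolding P_def M_def by auto
    have conv: "convex P" "convex M" "convex E"
      unfolding P_def M_def E_def
      by (intro convex_linear_preimage lin \<open>convex U\<close> convex_real_interval convex_singleton)+
    have sub: "P \<subseteq> U" "M \<subseteq> U" "E \<subseteq> U" unfolding P_def M_def E_def by auto
    have "x \<notin> N P" "x \<notin> N M" "x \<notin> N E" unfolding P_def M_def E_def N_def by force+
    then have lt: "card (N P) < card (N U)" "card (N M) < card (N U)" "card (N E) < card (N U)"
      using smaller sub by auto
    have IH: "acyclic_Z2 p (visible_faces f Q U')"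
      if "card (N U') < card (N U)" "convex U'" "U' \<noteq> {}" "U' \<subseteq> U" "p \<le> m" for U' p
      using less.hyps[of U' p] that less.prems(3) unfolding N_def by auto
    have ac: "acyclic_Z2 q (visible_faces f Q P)" "acyclic_Z2 q (visible_faces f Q M)"
        "acyclic_Z2 (q - 1) (visible_faces f Q E)"
      using IH lt conv ne sub less.prems(4) by auto
    have "visible_faces f Q P \<inter> visible_faces f Q M = visible_faces f Q E"
    proof (intro equalityI subsetI)
      fix \<tau> assume "\<tau> \<in> visible_faces f Q P \<inter> visible_faces f Q M"
      then obtain u w where uw: "\<tau> \<in> Q" "u \<in> P" "w \<in> M" "\<forall>v\<in>\<tau>. 0 < f v u" "\<forall>v\<in>\<tau>. 0 < f v w"
        unfolding visible_faces_def by auto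
      \<comment> \<open>The segment from \<open>u\<close> to \<open>w\<close> crosses the hyperplane
        at a point of \<open>E\<close>; positivity on \<open>\<tau>\<close> holds at both ends,
        hence along the segment.\<close>
      have "0 < f x u" "f x w \<le> 0" using uw unfolding P_def M_def by auto
      then obtain s where s: "0 \<le> s" "s \<le> 1" "f x ((1 - s) *\<^sub>R u + s *\<^sub>R w) = 0"
        using convex_crossing[OF lin[of x], of u w] by blast
      have "(1 - s) *\<^sub>R u + s *\<^sub>R w \<in> E"
        unfolding E_def using s uw sub \<open>convex U\<close> by (auto intro!: convexD)
      moreover have "\<forall>v\<in>\<tau>. 0 < f v ((1 - s) *\<^sub>R u + s *\<^sub>R w)"
        using positive_segment[OF lin] uw s by blast
      ultimately show "\<tau> \<in> visible_faces f Q E" using uw unfolding visible_faces_def by blast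
    next
      fix \<tau> assume "\<tau> \<in> visible_faces f Q E"
      then obtain u where u: "\<tau> \<in> Q" "u \<in> E" "\<forall>v\<in>\<tau>. 0 < f v u"
        unfolding visible_faces_def by auto
      \<comment> \<open>A direction on the hyperplane is pushed slightly towards \<open>a\<close>,
        where \<open>f x\<close> is positive.\<close>
      obtain s where s: "0 < s" "s < 1" "\<forall>v\<in>\<tau>. 0 < f v (u + s *\<^sub>R (a - u))"
        using positive_perturbation[of \<tau> f u "a - u"] simplicial_complexD(2)[OF Q u(1)] lin u(3)
        by blast
      have eq: "u + s *\<^sub>R (a - u) = (1 - s) *\<^sub>R u + s *\<^sub>R a" by (simp add: algebra_simps)
      have "(1 - s) *\<^sub>R u + s *\<^sub>R a \<in> U"
        using s u sub x \<open>convex U\<close> by (auto intro!: convexD)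
      moreover have "0 < f x ((1 - s) *\<^sub>R u + s *\<^sub>R a)"
        using u x s unfolding E_def by (simp add: linear_add[OF lin] linear_scale[OF lin])
      ultimately have "u + s *\<^sub>R (a - u) \<in> P" unfolding P_def eq by auto
      then have "\<tau> \<in> visible_faces f Q P" using u s unfolding visible_faces_def by blast
      moreover have "u \<in> M" using u unfolding E_def M_def by auto
      ultimately show "\<tau> \<in> visible_faces f Q P \<inter> visible_faces f Q M"
        using u unfolding visible_faces_def by blast
    qed
    moreover have "visible_faces f Q U = visible_faces f Q P \<union> visible_faces f Q M"
    proof -
      have "U = P \<union> M" unfolding P_def M_def by auto
      then show ?thesis unfolding visible_faces_def by blast
    qed
    ultimately show ?thesis
      using acyclic_Un[of "visible_faces f Q P" "visible_faces f Q M" q] ac ne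
        simplicial_complex_visible[OF Q] by metis
  qed
qed

section \<open>Coordinate subspaces and the descent in dimension\<close>

lemma lookup_scaleR [simp]:
  "Poly_Mapping.lookup (r *\<^sub>R (x :: 'a \<Rightarrow>\<^sub>0 'b::real_vector)) i = r *\<^sub>R Poly_Mapping.lookup x i"
proof -
  have "finite {i. r *\<^sub>R Poly_Mapping.lookup x i \<noteq> 0}"
    by (rule finite_subset[OF _ finite_keys[of x]]) (auto simp: in_keys_iff)
  then show ?thesis by (simp add: scaleR_poly_mapping_def)
qed

lemma mem_coord_space_iff:
  "x \<in> coord_space S \<longleftrightarrow> (\<forall>i. i \<notin> S \<longrightarrow> Poly_Mapping.lookup x i = 0)"
  by (auto simp: coord_space_def in_keys_iff)

lemma coord_space_add_scaleR:
  fixes u w :: "'a \<Rightarrow>\<^sub>0 real"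
  assumes "u \<in> coord_space S" "w \<in> coord_space S"
  shows "a *\<^sub>R u + b *\<^sub>R w \<in> coord_space S"
  using assms by (simp add: mem_coord_space_iff lookup_add)

lemma convex_coord_space: "convex (coord_space S :: ('a \<Rightarrow>\<^sub>0 real) set)"
  by (simp add: convex_def coord_space_add_scaleR)

lemma basis_vec_in_coord_space: "basis_vec i \<in> coord_space S \<longleftrightarrow> i \<in> S"
  by (simp add: basis_vec_def coord_space_def)

lemma linear_lookup: "linear (\<lambda>u :: 'a \<Rightarrow>\<^sub>0 real. c * Poly_Mapping.lookup u i)"
  by (rule linearI) (simp_all add: lookup_add algebra_simps)

text \<open>Induction on \<open>r\<close>, reading \<open>acyclic_Int\<close> contrapositively. The
  complexes of the two open halves of \<open>coord_space {..<Suc r}\<close> have the complex of the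
  whole space as union and that of \<open>coord_space {..<r}\<close> as intersection. Both halves
  avoid 0 and give acyclic complexes in degree \<open>r - 1\<close>, which is at most
  \<open>d - 2\<close> because \<open>Suc r \<le> d\<close>.\<close>

lemma not_acyclic_visible:
  fixes f :: "'b \<Rightarrow> (nat \<Rightarrow>\<^sub>0 real) \<Rightarrow> real"
  assumes Q: "simplicial_complex Q" and W: "finite W" "\<Union>Q \<subseteq> W"
    and lin: "\<And>v. linear (f v)"
    and base: "\<And>u q. u \<in> coord_space {..<d} - {0} \<Longrightarrow> q \<le> int d - 2 \<Longrightarrow>
      acyclic_Z2 q {\<tau> \<in> Q. \<forall>v\<in>\<tau>. 0 < f v u}"
    and "r \<le> d"
  shows "\<not> acyclic_Z2 (int r - 1) (visible_faces f Q (coord_space {..<r}))"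
  using assms(6)
proof (induction r)
  case 0
  have "coord_space {..<0::nat} = {0 :: nat \<Rightarrow>\<^sub>0 real}"
    by (auto simp: coord_space_def)
  \<comment> \<open>At the direction 0 no vertex is positive, so only the empty face is
    visible.\<close>
  moreover have "f v 0 = 0" for v by (rule linear_0[OF lin])
  ultimately have "visible_faces f Q (coord_space {..<0}) = {{}}"
    using simplicial_complexD(1)[OF Q] unfolding visible_faces_def by auto
  then show ?case using not_acyclic_empty_face by simp
next
  case (Suc r)
  \<comment> \<open>The sign of \<open>s\<close> selects the half, so that one argument treats
    \<open>H 1\<close> and \<open>H (-1)\<close>.\<close>
  define H :: "real \<Rightarrow> (nat \<Rightarrow>\<^sub>0 real) set"
    where "H s = {u \<in> coord_space {..<Suc r}. s * Poly_Mapping.lookup u r \<in> {0<..}}" for s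
  have sub: "coord_space {..<r} \<subseteq> (coord_space {..<Suc r} :: (nat \<Rightarrow>\<^sub>0 real) set)"
      "coord_space {..<Suc r} \<subseteq> (coord_space {..<d} :: (nat \<Rightarrow>\<^sub>0 real) set)"
    using Suc.prems unfolding coord_space_def by auto
  have H: "acyclic_Z2 (int r - 1) (visible_faces f Q (H s))" "H s \<noteq> {}" if "s \<noteq> 0" for s
  proof -
    have *: "s *\<^sub>R basis_vec r \<in> H s"
      using that coord_space_add_scaleR[of "basis_vec r" "{..<Suc r}" "basis_vec r" s 0]
      by (simp add: H_def basis_vec_in_coord_space)
        (auto simp: basis_vec_def zero_less_mult_iff linorder_neq_iff)
    then show "H s \<noteq> {}" by blast
    have "convex (H s)"
      unfolding H_def by (intro convex_linear_preimage linear_lookup convex_coord_space convex_real_interval)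
    moreover have "H s \<subseteq> coord_space {..<d} - {0}"
      using sub unfolding H_def by auto
    ultimately show "acyclic_Z2 (int r - 1) (visible_faces f Q (H s))"
      using * Suc.prems
      by (intro acyclic_visible_convex[OF Q W lin base, where m = "int d - 2"]) auto
  qed
  \<comment> \<open>A direction in the closed half moves into the open half by a small step along
    \<open>s *\<^sub>R basis_vec r\<close>; hence faces visible from the hyperplane are visible from
    both open halves.\<close>
  have enter: "\<tau> \<in> visible_faces f Q (H s)"
    if hyps: "\<tau> \<in> Q" "u \<in> coord_space {..<Suc r}" "\<forall>v\<in>\<tau>. 0 < f v u" "0 \<le> s * Poly_Mapping.lookup u r"
      "s \<noteq> 0" for \<tau> u s
  proof -
    obtain t where "t < 1" and t: "0 < t" "\<forall>v\<in>\<tau>. 0 < f v (u + t *\<^sub>R (s *\<^sub>R basis_vec r))"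
      by (rule positive_perturbation[OF simplicial_complexD(2)[OF Q hyps(1)] lin hyps(3)])
    have "u + t *\<^sub>R (s *\<^sub>R basis_vec r) \<in> coord_space {..<Suc r}"
      using coord_space_add_scaleR[of u "{..<Suc r}" "basis_vec r" 1 "t * s"] hyps
      by (simp add: basis_vec_in_coord_space)
    moreover have "0 < s * Poly_Mapping.lookup (u + t *\<^sub>R (s *\<^sub>R basis_vec r)) r"
    proof -
      have "0 < t * (s * s)" using t hyps(5) by (auto simp: zero_less_mult_iff)
      then show ?thesis using hyps(4) by (simp add: lookup_add basis_vec_def algebra_simps)
    qed
    ultimately show ?thesis using t(2) hyps(1) unfolding visible_faces_def H_def
      by (intro CollectI conjI bexI[of _ "u + t *\<^sub>R (s *\<^sub>R basis_vec r)"]) auto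
  qed
  let ?P = "visible_faces f Q (H 1)" and ?M = "visible_faces f Q (H (-1))"
  have "?P \<union> ?M = visible_faces f Q (coord_space {..<Suc r})"
  proof (intro equalityI subsetI)
    fix \<tau> assume "\<tau> \<in> visible_faces f Q (coord_space {..<Suc r})"
    then obtain u where u: "\<tau> \<in> Q" "u \<in> coord_space {..<Suc r}" "\<forall>v\<in>\<tau>. 0 < f v u"
      unfolding visible_faces_def by auto
    show "\<tau> \<in> ?P \<union> ?M"
      using enter[OF u, of 1] enter[OF u, of "-1"] by (cases "0 \<le> Poly_Mapping.lookup u r") auto
  qed (auto simp: visible_faces_def H_def)
  moreover have "?P \<inter> ?M = visible_faces f Q (coord_space {..<r})"
  proof (intro equalityI subsetI)
    fix \<tau> assume "\<tau> \<in> ?P \<inter> ?M"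
    then obtain u w where uw: "\<tau> \<in> Q" "u \<in> H 1" "w \<in> H (-1)" "\<forall>v\<in>\<tau>. 0 < f v u" "\<forall>v\<in>\<tau>. 0 < f v w"
      unfolding visible_faces_def by auto
    have "0 < 1 * Poly_Mapping.lookup u r" "1 * Poly_Mapping.lookup w r \<le> 0"
      using uw unfolding H_def by auto
    then obtain s where s: "0 \<le> s" "s \<le> 1"
        "1 * Poly_Mapping.lookup ((1 - s) *\<^sub>R u + s *\<^sub>R w) r = 0"
      using convex_crossing[OF linear_lookup[of 1 r], of u w] by blast
    define x where "x = (1 - s) *\<^sub>R u + s *\<^sub>R w"
    have "x \<in> coord_space {..<Suc r}"
      using uw unfolding H_def x_def by (auto intro: coord_space_add_scaleR)
    moreover have "Poly_Mapping.lookup x r = 0" using s(3) unfolding x_def by simp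
    ultimately have "x \<in> coord_space {..<r}"
      unfolding mem_coord_space_iff lessThan_iff by (metis less_antisym)
    moreover have "\<forall>v\<in>\<tau>. 0 < f v x"
      unfolding x_def using positive_segment[OF lin] uw s by blast
    ultimately show "\<tau> \<in> visible_faces f Q (coord_space {..<r})"
      using uw unfolding visible_faces_def by blast
  next
    fix \<tau> assume "\<tau> \<in> visible_faces f Q (coord_space {..<r})"
    then obtain u where u: "\<tau> \<in> Q" "u \<in> coord_space {..<r}" "\<forall>v\<in>\<tau>. 0 < f v u"
      unfolding visible_faces_def by auto
    then have "Poly_Mapping.lookup u r = 0" unfolding coord_space_def by (auto simp: in_keys_iff)
    then show "\<tau> \<in> ?P \<inter> ?M"
      using enter[OF u(1) _ u(3), of 1] enter[OF u(1) _ u(3), of "-1"] u(2) sub by auto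
  qed
  moreover have "\<not> acyclic_Z2 (int r - 1) (visible_faces f Q (coord_space {..<r}))"
    using Suc by simp
  ultimately show ?case
    using acyclic_Int[of ?P ?M "int r"] H[of 1] H[of "-1"] simplicial_complex_visible[OF Q, of _ f]
    by auto
qed

text \<open>The core of the theorem, under the extra hypothesis \<open>cover\<close> that every
  colour class meets every open half-space. Of the tree, only the full skeleton below dimension
  \<open>k\<close> and acyclicity in degree \<open>k - 1\<close> enter, so that the lemma applies to
  blow-ups of spanning trees.\<close>

lemma colorful_half_spaces:
  fixes f :: "'b \<Rightarrow> (nat \<Rightarrow>\<^sub>0 real) \<Rightarrow> real" and V :: "nat \<Rightarrow> 'b set"
  assumes "k \<le> d" and lin: "\<And>v. linear (f v)"
    and V: "\<And>i. i \<in> {1..d+1} \<Longrightarrow> finite (V i) \<and> V i \<noteq> {}" "disjoint_family_on V {1..d+1}"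
    and cover: "\<And>i u. i \<in> {1..d+1} \<Longrightarrow> u \<in> coord_space {..<d} - {0} \<Longrightarrow> \<exists>v\<in>V i. 0 < f v u"
    and T: "simplicial_complex T" "T \<subseteq> color_join V 1 (k+1)"
    and skeleton: "\<And>\<sigma>. \<sigma> \<in> color_join V 1 (k+1) \<Longrightarrow> face_dim \<sigma> \<le> int k - 1 \<Longrightarrow> \<sigma> \<in> T"
    and acyclic: "acyclic_Z2 (int k - 1) T"
  shows "\<exists>\<tau>\<in>complex_join T (color_join V (k+2) (d+1)). \<forall>u\<in>coord_space {..<d}. \<exists>v\<in>\<tau>. f v u \<le> 0"
proof (rule ccontr)
  define L R where "L = [1..<k+2]" and "R = [k+2..<d+2]"
  have X: "color_join V 1 (k+1) = list_join V L" and
      "color_join V (k+2) (d+1) = list_join V R"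
    by (simp_all add: color_join_eq_list_join L_def R_def del: upt_Suc)
  define Q where "Q = complex_join T (list_join V R)"
  assume "\<not> (\<exists>\<tau>\<in>complex_join T (color_join V (k+2) (d+1)).
    \<forall>u\<in>coord_space {..<d}. \<exists>v\<in>\<tau>. f v u \<le> 0)"
  then have visible: "\<exists>u\<in>coord_space {..<d}. \<forall>v\<in>\<tau>. 0 < f v u" if "\<tau> \<in> Q" for \<tau>
    using that \<open>color_join V (k+2) (d+1) = list_join V R\<close> unfolding Q_def by (metis not_le)
  have len: "int (length L) = int k + 1" "int (length R) = int d - int k"
    using \<open>k \<le> d\<close> by (simp_all add: L_def R_def)
  have dist: "distinct L" "distinct R" by (simp_all add: L_def R_def)
  have sets: "set L \<subseteq> {1..d+1}" "set R \<subseteq> {1..d+1}" "set L \<inter> set R = {}"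
    using \<open>k \<le> d\<close> by (auto simp: L_def R_def)
  have disj: "disjoint_family_on V (set L)" "disjoint_family_on V (set R)"
    using V(2) sets by (auto intro: disjoint_family_on_mono)
  have "\<Union>T \<subseteq> (\<Union>i\<in>set L. V i)"
    using T(2) mem_list_join_iff[OF dist(1) disj(1)] unfolding X by blast
  moreover have "V i \<inter> V j = {}" if "i \<in> set R" "j \<in> set L" for i j
    using that sets V(2) by (intro disjoint_family_onD[of V "{1..d+1}"]) auto
  ultimately have apart: "V i \<inter> \<Union>T = {}" if "i \<in> set R" for i using that by blast
  have Q: "simplicial_complex Q"
    unfolding Q_def by (intro simplicial_complex_join T simplicial_complex_list_join)
  \<comment> \<open>The \<open>d - k\<close> remaining colours raise the degree from
    \<open>k - 1\<close> to \<open>d - 1\<close>.\<close>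
  have "acyclic_Z2 (int k - 1 + int (length R)) Q"
    unfolding Q_def using V(1) sets(2) apart
    by (intro acyclic_join_list_join T acyclic dist disj) auto
  then have acQ: "acyclic_Z2 (int d - 1) Q" by (simp add: len)
  have base: "acyclic_Z2 q {\<tau> \<in> Q. \<forall>v\<in>\<tau>. 0 < f v u}"
    if u: "u \<in> coord_space {..<d} - {0}" and q: "q \<le> int d - 2" for u q
  proof -
    \<comment> \<open>For a single direction the visible part is again a join, of the restrictions
      to \<open>S\<close>; \<open>cover\<close> keeps every colour class nonempty.\<close>
    define S where "S = {v. 0 < f v u}"
    have VS: "finite (V i \<inter> S) \<and> V i \<inter> S \<noteq> {}" if "i \<in> {1..d+1}" for i
      using V(1)[OF that] cover[OF that u] unfolding S_def by auto
    have disjS: "disjoint_family_on (\<lambda>i. V i \<inter> S) (set L)"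
        "disjoint_family_on (\<lambda>i. V i \<inter> S) (set R)"
      using disj unfolding disjoint_family_on_def by blast+
    let ?T = "{\<sigma> \<in> T. \<sigma> \<subseteq> S}"
    have acS: "acyclic_Z2 (q - int (length R)) (list_join (\<lambda>i. V i \<inter> S) L)"
      using VS sets(1) q len by (intro acyclic_list_join dist disjS) auto
    \<comment> \<open>Up to dimension \<open>q - length R + 1\<close>, which is at most
      \<open>k - 1\<close>, the tree contains all faces of the full join, so the acyclicity of the
      restricted join carries over to \<open>?T\<close>.\<close>
    have "\<sigma> \<in> ?T \<longleftrightarrow> \<sigma> \<in> list_join (\<lambda>i. V i \<inter> S) L"
      if "face_dim \<sigma> \<le> q - int (length R) + 1" for \<sigma>
      using T(2) skeleton[of \<sigma>] that q len unfolding X restrict_list_join[symmetric] by auto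
    then have "acyclic_Z2 (q - int (length R)) ?T"
      using acS acyclic_cong[of "q - int (length R)" ?T "list_join (\<lambda>i. V i \<inter> S) L"] by blast
    moreover have apartS: "(V i \<inter> S) \<inter> \<Union>?T = {}" if "i \<in> set R" for i
      using apart[OF that] by blast
    moreover have "simplicial_complex ?T"
      using simplicial_complexD[OF T(1)] unfolding simplicial_complex_def by auto
    ultimately have "acyclic_Z2 (q - int (length R) + int (length R))
        (complex_join ?T (list_join (\<lambda>i. V i \<inter> S) R))"
      using VS sets(2) apartS by (intro acyclic_join_list_join dist disjS) auto
    moreover have "{\<tau> \<in> Q. \<forall>v\<in>\<tau>. 0 < f v u} = complex_join ?T (list_join (\<lambda>i. V i \<inter> S) R)"
      unfolding Q_def restrict_list_join[symmetric] restrict_complex_join[symmetric] S_def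
      by auto
    ultimately show ?thesis by simp
  qed
  have "\<tau> \<subseteq> (\<Union>i\<in>{1..d+1}. V i)" if \<tau>: "\<tau> \<in> Q" for \<tau>
  proof -
    obtain a b where ab: "a \<in> T" "b \<in> list_join V R" "\<tau> = a \<union> b"
      using \<tau> unfolding Q_def complex_join_def by blast
    have "a \<subseteq> (\<Union>i\<in>set L. V i)" using ab(1) \<open>\<Union>T \<subseteq> (\<Union>i\<in>set L. V i)\<close> by blast
    moreover have "b \<subseteq> (\<Union>i\<in>set R. V i)"
      using ab(2) mem_list_join_iff[OF dist(2) disj(2)] by blast
    moreover have "(\<Union>i\<in>set L. V i) \<subseteq> (\<Union>i\<in>{1..d+1}. V i)"
        "(\<Union>i\<in>set R. V i) \<subseteq> (\<Union>i\<in>{1..d+1}. V i)"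
      by (rule UN_mono[OF sets(1) order.refl]) (rule UN_mono[OF sets(2) order.refl])
    ultimately show ?thesis unfolding ab(3) by (meson Un_least order.trans)
  qed
  then have sub: "\<Union>Q \<subseteq> (\<Union>i\<in>{1..d+1}. V i)" by blast
  have fin: "finite (\<Union>i\<in>{1..d+1}. V i)" using V(1) by blast
  have "\<not> acyclic_Z2 (int d - 1) (visible_faces f Q (coord_space {..<d}))"
    by (rule not_acyclic_visible[OF Q fin sub lin base order.refl])
  \<comment> \<open>The assumption for contradiction says exactly that every face of
    \<open>Q\<close> is visible from some direction.\<close>
  moreover have "visible_faces f Q (coord_space {..<d}) = Q"
    using visible unfolding visible_faces_def by blast
  ultimately show False using acQ by simp
qed

section \<open>Spanning trees\<close>

text \<open>In the top degree the only boundary is 0, so the quotient is the group of cycles with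
  each cycle wrapped as a singleton coset.\<close>

lemma trivial_reduced_homology_iff:
  assumes "\<And>\<sigma>. \<sigma> \<in> K \<Longrightarrow> face_dim \<sigma> \<le> p"
  shows "trivial_group (reduced_homology_Z2 K p) \<longleftrightarrow> cycles_Z2 K p = {0}"
proof -
  have "c = 0" if "c \<in> carrier (chain_group_Z2 K (p + 1))" for c
  proof -
    have "keys c = {}" using that assms by (fastforce simp: chain_group_Z2_def)
    then show ?thesis by simp
  qed
  moreover have "0 \<in> carrier (chain_group_Z2 K (p + 1))" by (simp add: chain_group_Z2_def)
  ultimately have "carrier (chain_group_Z2 K (p + 1)) = {0}" by blast
  then have B: "boundaries_Z2 K p = {0}" by (simp add: boundaries_Z2_def)
  have carrier: "carrier (reduced_homology_Z2 K p) = (\<lambda>c. {c}) ` cycles_Z2 K p"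
    and one: "\<one>\<^bsub>reduced_homology_Z2 K p\<^esub> = {0}"
    and mult: "{a} \<otimes>\<^bsub>reduced_homology_Z2 K p\<^esub> {b} = {a + b}" for a b
    by (auto simp: reduced_homology_Z2_def FactGroup_def RCOSETS_def r_coset_def B
        chain_group_Z2_def set_mult_def)
  show ?thesis
  proof
    assume "trivial_group (reduced_homology_Z2 K p)"
    then show "cycles_Z2 K p = {0}" unfolding trivial_group_def carrier one by auto
  next
    assume "cycles_Z2 K p = {0}"
    then have c: "carrier (reduced_homology_Z2 K p) = {{0}}" by (simp add: carrier)
    have "group (reduced_homology_Z2 K p)"
      by (rule groupI) (auto simp: c one mult)
    then show "trivial_group (reduced_homology_Z2 K p)" by (simp add: trivial_group_def c one)
  qed
qed

text \<open>Adding a missing \<open>\<sigma>\<close> to \<open>T\<close> creates a nonzero cycle,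
  which must contain \<open>\<sigma>\<close> because \<open>T\<close> has none. The rest of that
  cycle lies in \<open>T\<close> and has the same boundary as \<open>\<sigma>\<close>.\<close>

lemma spanning_tree_fill:
  assumes "spanning_tree_Z2 k X T" "\<sigma> \<in> X" "face_dim \<sigma> = int k"
  shows "\<exists>c\<in>chain_space T (int k). boundary_Z2 c = simplex_boundary \<sigma>"
proof (cases "\<sigma> \<in> T")
  case True
  then show ?thesis using assms(3) by (intro bexI[of _ "simplex_chain \<sigma>"]) 
      (auto simp: boundary_single intro: chains_single)
next
  case False
  have X: "simplicial_complex X" "\<And>\<tau>. \<tau> \<in> X \<Longrightarrow> face_dim \<tau> \<le> int k" "T \<subseteq> X"
    using assms(1) unfolding spanning_tree_Z2_def complex_of_dim_def by auto
  \<comment> \<open>The maximality condition on the tree speaks of facets; a face of the top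
    dimension \<open>k\<close> is one.\<close>
  have "facet X \<sigma>"
    unfolding facet_def
  proof (intro conjI ballI impI)
    fix \<tau> assume "\<tau> \<in> X" "\<sigma> \<subseteq> \<tau>"
    then have "card \<tau> \<le> card \<sigma>" "finite \<tau>"
      using X(2)[of \<tau>] assms(3) simplicial_complexD(2)[OF X(1)] by (auto simp: face_dim_def)
    then show "\<tau> = \<sigma>" using \<open>\<sigma> \<subseteq> \<tau>\<close> card_seteq by metis
  qed fact
  then have "\<not> trivial_group (reduced_homology_Z2 (T \<union> {\<sigma>}) (int k))"
      "trivial_group (reduced_homology_Z2 T (int k))"
    using assms(1) False unfolding spanning_tree_Z2_def by auto
  moreover have "face_dim \<tau> \<le> int k" if "\<tau> \<in> T \<union> {\<sigma>}" for \<tau>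
    using X(2,3) assms(2) that by blast
  ultimately have cyc: "cycles_Z2 (T \<union> {\<sigma>}) (int k) \<noteq> {0}" "cycles_Z2 T (int k) = {0}"
    using trivial_reduced_homology_iff[of "T \<union> {\<sigma>}" "int k"]
      trivial_reduced_homology_iff[of T "int k"] by simp_all
  have cycles: "cycles_Z2 K p = {c \<in> chain_space K p. boundary_Z2 c = 0}" for K :: "'a set set" and p
    by (simp add: cycles_Z2_def chain_group_Z2_def chain_space_def)
  obtain z where z: "z \<in> chain_space (T \<union> {\<sigma>}) (int k)" "boundary_Z2 z = 0" "z \<noteq> 0"
    using cyc(1) unfolding cycles by auto
  obtain a b where ab: "a \<in> chain_space T (int k)" "b \<in> chain_space {\<sigma>} (int k)" "z = a + b"
    using chains_Un_split[OF z(1)] .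
  have "keys b \<subseteq> {\<sigma>}" using ab(2) by (auto simp: chain_space_def)
  moreover have "keys b \<noteq> {}"
  proof
    assume "keys b = {}"
    then have "b = 0" by simp
    then have "z \<in> cycles_Z2 T (int k)" using ab z unfolding cycles by simp
    then show False using cyc z by simp
  qed
  ultimately have "keys b = {\<sigma>}" by blast
  then have "b = simplex_chain \<sigma>" by (metis chain_eq_sum finite.emptyI sum.insert sum.empty
      add.right_neutral empty_iff)
  then have "boundary_Z2 a = simplex_boundary \<sigma>"
    using z(2) ab(3) by (simp add: boundary_single chain_add_eq_0_iff)
  then show ?thesis using ab(1) by blast
qed

text \<open>A cycle of \<open>T\<close> is filled in \<open>X\<close>, and each
  \<open>p\<close>-simplex of that filling is then replaced by a chain of \<open>T\<close> with the
  same boundary.\<close>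

lemma acyclic_of_fill:
  assumes X: "simplicial_complex X" "acyclic_Z2 (p - 1) X" and "T \<subseteq> X"
    and fill: "\<And>\<sigma>. \<sigma> \<in> X \<Longrightarrow> face_dim \<sigma> = p \<Longrightarrow> \<exists>c\<in>chain_space T p. boundary_Z2 c = simplex_boundary \<sigma>"
  shows "acyclic_Z2 (p - 1) T"
  unfolding acyclic_Z2_def
proof (intro ballI impI)
  fix z assume "z \<in> chain_space T (p - 1)" "boundary_Z2 z = 0"
  then have "z \<in> chain_space X (p - 1)" using chains_mono[OF \<open>T \<subseteq> X\<close>] by blast
  then obtain c where c: "c \<in> chain_space X p" "boundary_Z2 c = z"
    using X(2) \<open>boundary_Z2 z = 0\<close> unfolding acyclic_Z2_def by fastforce
  have "\<exists>e\<in>chain_space T p. boundary_Z2 e = boundary_Z2 c"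
    using c(1)
  proof (induction rule: chains_induct)
    case zero
    show ?case by (intro bexI[of _ 0]) auto
  next
    case (add \<sigma> c)
    then obtain e e' where "e \<in> chain_space T p" "boundary_Z2 e = boundary_Z2 c"
        "e' \<in> chain_space T p" "boundary_Z2 e' = simplex_boundary \<sigma>"
      using fill by blast
    then show ?case
      by (intro bexI[of _ "e' + e"]) (auto simp: boundary_single intro: chains_add)
  qed
  then show "\<exists>c\<in>chain_space T (p - 1 + 1). boundary_Z2 c = z" using c by simp
qed

section \<open>Pushing chains forward along an injection\<close>

definition map_chain :: "('a \<Rightarrow> 'b) \<Rightarrow> 'a chain \<Rightarrow> 'b chain" where
  "map_chain s = chain_extend (\<lambda>\<sigma>. simplex_chain (s ` \<sigma>))"

lemma map_chain_simplex_boundary: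
  assumes "inj_on s \<sigma>"
  shows "map_chain s (simplex_boundary \<sigma>) = simplex_boundary (s ` \<sigma>)"
proof -
  have "simplex_boundary (s ` \<sigma>) = (\<Sum>v\<in>\<sigma>. simplex_chain (s ` \<sigma> - {s v}))"
    unfolding simplex_boundary_def by (simp add: sum.reindex[OF assms])
  also have "\<dots> = (\<Sum>v\<in>\<sigma>. simplex_chain (s ` (\<sigma> - {v})))"
    using assms by (intro sum.cong refl arg_cong[of _ _ simplex_chain]) (auto simp: inj_on_def)
  finally show ?thesis
    by (simp add: map_chain_def simplex_boundary_def chain_extend_sum)
qed

text \<open>Injectivity prevents a simplex from collapsing, so \<open>map_chain\<close> can do
  without a clause for degenerate images.\<close>

lemma boundary_map_chain:
  assumes "inj s"
  shows "boundary_Z2 (map_chain s c) = map_chain s (boundary_Z2 c)"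
proof -
  have "keys c \<subseteq> UNIV" by simp
  then show ?thesis
  proof (induction rule: chain_induct)
    case (add \<sigma> c)
    have "boundary_Z2 (map_chain s (simplex_chain \<sigma>)) = map_chain s (simplex_boundary \<sigma>)"
      using map_chain_simplex_boundary[OF inj_on_subset[OF assms]]
      by (simp add: map_chain_def boundary_single)
    then show ?case using add by (simp add: map_chain_def boundary_single)
  qed (simp add: map_chain_def)
qed

lemma map_chain_in_chain_space:
  assumes "inj s" "c \<in> chain_space K p" "\<And>\<sigma>. \<sigma> \<in> K \<Longrightarrow> s ` \<sigma> \<in> L"
  shows "map_chain s c \<in> chain_space L p"
  using assms(2)
proof (induction rule: chains_induct)
  case (add \<sigma> c)
  have "face_dim (s ` \<sigma>) = p"
    using add card_image[OF inj_on_subset[OF assms(1)]] by (simp add: face_dim_def)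
  then show ?case using add assms(3)
    by (auto simp: map_chain_def intro!: chains_add chains_single)
qed (simp add: map_chain_def)

section \<open>Blowing up the vertices\<close>

lemma fst_image_list_join: "\<sigma> \<in> list_join (\<lambda>i. V i \<times> J) is \<Longrightarrow> fst ` \<sigma> \<in> list_join V is"
proof (induction "is" arbitrary: \<sigma>)
  case (Cons i "is")
  then obtain a b where ab: "a \<in> discrete_complex (V i \<times> J)" "b \<in> list_join (\<lambda>i. V i \<times> J) is"
      "\<sigma> = a \<union> b"
    by (auto simp: complex_join_def)
  have "fst ` a \<in> discrete_complex (V i)" using ab(1) by (auto simp: discrete_complex_def)
  then show ?case using Cons.IH[OF ab(2)] ab(3) by (auto simp: complex_join_def image_Un)
qed simp

text \<open>Points over the same vertex share its colour, and a face has at most one point of each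
  colour.\<close>

lemma inj_on_fst_list_join:
  assumes "distinct is" "disjoint_family_on V (set is)" "\<sigma> \<in> list_join (\<lambda>i. V i \<times> J) is"
  shows "inj_on fst \<sigma>"
proof (rule inj_onI)
  have "disjoint_family_on (\<lambda>i. V i \<times> J) (set is)"
    using assms(2) by (auto simp: disjoint_family_on_def)
  note mem = mem_list_join_iff[OF assms(1) this, THEN iffD1, OF assms(3)]
  fix x y assume xy: "x \<in> \<sigma>" "y \<in> \<sigma>" "fst x = fst y"
  have "x \<in> (\<Union>i\<in>set is. V i \<times> J)" "y \<in> (\<Union>i\<in>set is. V i \<times> J)" using mem xy by blast+
  then obtain i where i: "i \<in> set is" "x \<in> V i \<times> J" "snd y \<in> J" by auto
  then have "y \<in> V i \<times> J" using xy(3) by (metis mem_Times_iff)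
  then show "x = y" using mem i xy by blast
qed

text \<open>The preimage of \<open>T\<close> need not be a spanning tree, but it still fills the
  boundary of every \<open>k\<close>-face of the blown-up join, and that is enough for
  \<open>acyclic_of_fill\<close>.\<close>

lemma acyclic_blowup:
  fixes V :: "nat \<Rightarrow> 'a set" and J :: "'j set"
  assumes V: "\<And>i. i \<in> {1..k+1} \<Longrightarrow> finite (V i) \<and> V i \<noteq> {}" "disjoint_family_on V {1..k+1}"
    and J: "finite J" "e \<in> J"
    and T: "spanning_tree_Z2 k (color_join V 1 (k+1)) T"
  shows "acyclic_Z2 (int k - 1) {\<sigma> \<in> color_join (\<lambda>i. V i \<times> J) 1 (k+1). fst ` \<sigma> \<in> T}"
proof -
  define L where "L = [1..<k+2]"
  have L: "distinct L" "set L = {1..k+1}" "length L = k+1" by (auto simp: L_def)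
  define X X' where "X = list_join V L" and "X' = list_join (\<lambda>i. V i \<times> J) L"
  have X: "color_join V 1 (k+1) = X" "color_join (\<lambda>i. V i \<times> J) 1 (k+1) = X'"
    by (simp_all add: X_def X'_def color_join_eq_list_join L_def del: upt_Suc)
  have disj: "disjoint_family_on V (set L)" "disjoint_family_on (\<lambda>i. V i \<times> J) (set L)"
    using V(2) by (auto simp: disjoint_family_on_def L)
  have sub: "T \<subseteq> X" using T unfolding X spanning_tree_Z2_def by blast
  show ?thesis
    unfolding X
  proof (rule acyclic_of_fill)
    show "simplicial_complex X'" unfolding X'_def by (rule simplicial_complex_list_join)
    show "acyclic_Z2 (int k - 1) X'"
      unfolding X'_def using V(1) J L by (intro acyclic_list_join L disj) auto
    fix \<sigma> assume \<sigma>: "\<sigma> \<in> X'" "face_dim \<sigma> = int k"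
    have inj: "inj_on fst \<sigma>"
      using inj_on_fst_list_join[OF L(1) disj(1)] \<sigma>(1) unfolding X'_def .
    have "fst ` \<sigma> \<in> X" using \<sigma>(1) unfolding X_def X'_def by (rule fst_image_list_join)
    moreover have "face_dim (fst ` \<sigma>) = int k"
      using \<sigma>(2) inj by (simp add: face_dim_def card_image)
    ultimately obtain c where c: "c \<in> chain_space T (int k)"
        "boundary_Z2 c = simplex_boundary (fst ` \<sigma>)"
      using spanning_tree_fill[OF T] unfolding X by blast
    \<comment> \<open>A section of the blow-up passing through \<open>\<sigma>\<close>: it lifts the filling of \<open>fst ` \<sigma>\<close> to one of \<open>\<sigma>\<close>.\<close>
    define s where "s v = (if v \<in> fst ` \<sigma> then inv_into \<sigma> fst v else (v, e))" for v
    have fst_s: "fst (s v) = v" for v by (simp add: s_def f_inv_into_f)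
    have "inj s" using fst_s by (metis injI)
    have snd_s: "snd (s v) \<in> J" for v
    proof (cases "v \<in> fst ` \<sigma>")
      case True
      then have "s v \<in> \<sigma>" by (simp add: s_def inv_into_into)
      moreover have "\<sigma> \<subseteq> (\<Union>i\<in>set L. V i \<times> J)"
        using \<sigma>(1) mem_list_join_iff[OF L(1) disj(2)] unfolding X'_def by blast
      ultimately show ?thesis by auto
    qed (simp add: s_def J)
    have "s ` fst ` \<sigma> = \<sigma>"
      using inj by (force simp: s_def image_image)
    have s_mem: "s v \<in> V i \<times> J \<longleftrightarrow> v \<in> V i" for v i
      using fst_s snd_s by (simp add: mem_Times_iff)
    \<comment> \<open>The section keeps colours, so it maps faces of \<open>T\<close> to rainbow
      sets; followed by \<open>fst\<close> it is the identity, so the image lies over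
      \<open>T\<close>.\<close>
    have "s ` \<rho> \<in> {\<sigma> \<in> X'. fst ` \<sigma> \<in> T}" if "\<rho> \<in> T" for \<rho>
    proof -
      have \<rho>: "\<rho> \<subseteq> (\<Union>i\<in>set L. V i)" "\<forall>i\<in>set L. \<forall>x\<in>\<rho> \<inter> V i. \<forall>y\<in>\<rho> \<inter> V i. x = y"
        using that sub mem_list_join_iff[OF L(1) disj(1)] unfolding X_def by blast+
      have "s ` \<rho> \<in> X'"
        unfolding X'_def mem_list_join_iff[OF L(1) disj(2)]
      proof (intro conjI ballI)
        show "s ` \<rho> \<subseteq> (\<Union>i\<in>set L. V i \<times> J)"
        proof (rule image_subsetI)
          fix v assume "v \<in> \<rho>"
          then obtain i where "i \<in> set L" "v \<in> V i" using \<rho>(1) by blast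
          then show "s v \<in> (\<Union>i\<in>set L. V i \<times> J)"
            using s_mem[of v i] by (intro UN_I[of i]) simp_all
        qed
      next
        fix i x y assume i: "i \<in> set L" and xy: "x \<in> s ` \<rho> \<inter> V i \<times> J" "y \<in> s ` \<rho> \<inter> V i \<times> J"
        obtain v w where vw: "v \<in> \<rho>" "x = s v" "w \<in> \<rho>" "y = s w"
          using IntD1[OF xy(1)] IntD1[OF xy(2)] by blast
        then have "v \<in> V i" "w \<in> V i" using xy s_mem[of v i] s_mem[of w i] by simp_all
        then have "v = w" using \<rho>(2) i vw(1,3) by blast
        then show "x = y" using vw by simp
      qed
      then show ?thesis using that by (simp add: image_image fst_s)
    qed
    then have "map_chain s c \<in> chain_space {\<sigma> \<in> X'. fst ` \<sigma> \<in> T} (int k)"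
      using map_chain_in_chain_space[OF \<open>inj s\<close> c(1)] by blast
    moreover have "boundary_Z2 (map_chain s c) = simplex_boundary \<sigma>"
      using boundary_map_chain[OF \<open>inj s\<close>, of c] c(2)
        map_chain_simplex_boundary[OF inj_on_subset[OF \<open>inj s\<close>], of "fst ` \<sigma>"]
        \<open>s ` fst ` \<sigma> = \<sigma>\<close> by simp
    ultimately show "\<exists>c\<in>chain_space {\<sigma> \<in> X'. fst ` \<sigma> \<in> T} (int k). boundary_Z2 c = simplex_boundary \<sigma>"
      by blast
  qed auto
qed

section \<open>Simplices and hulls\<close>

text \<open>Gordan's alternative. It is stated for a subspace \<open>M\<close> so that the induction
  on \<open>S\<close> can pass from \<open>M\<close> to the kernel of the new functional
  \<open>f w\<close> in \<open>M\<close>.\<close>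

lemma linear_alternative:
  fixes f :: "'b \<Rightarrow> 'u::real_vector \<Rightarrow> real"
  assumes "finite S" and lin: "\<And>v. linear (f v)" and "subspace M"
  shows "(\<exists>u\<in>M. \<forall>v\<in>S. 0 < f v u) \<or>
    (\<exists>l. (\<forall>v\<in>S. 0 \<le> l v) \<and> (\<exists>v\<in>S. 0 < l v) \<and> (\<forall>u\<in>M. (\<Sum>v\<in>S. l v * f v u) = 0))"
  using assms(1,3)
proof (induction S arbitrary: M rule: finite_induct)
  case empty
  then show ?case using subspace_0 by auto
next
  case (insert w S)
  have extend: "(\<Sum>v\<in>insert w S. (l(w := a)) v * f v u) = (\<Sum>v\<in>S. l v * f v u) + a * f w u"
    for l a u
  proof -
    have "(\<Sum>v\<in>S. (l(w := a)) v * f v u) = (\<Sum>v\<in>S. l v * f v u)"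
      using insert(2) by (intro sum.cong) auto
    then show ?thesis using insert(1,2) by simp
  qed
  have dependent: ?case
    if "\<forall>v\<in>S. 0 \<le> l v" "0 \<le> a" "(\<exists>v\<in>S. 0 < l v) \<or> 0 < a"
      "\<And>u. u \<in> M \<Longrightarrow> (\<Sum>v\<in>S. l v * f v u) + a * f w u = 0" for l a
  proof (rule disjI2, intro exI[of _ "l(w := a)"] conjI)
    show "\<forall>u\<in>M. (\<Sum>v\<in>insert w S. (l(w := a)) v * f v u) = 0"
      using that(4) by (simp only: extend) simp
  qed (use that insert(2) in auto)
  show ?case
  proof (cases "\<exists>u\<in>M. \<forall>v\<in>S. 0 < f v u")
    case False
    then obtain l where "\<forall>v\<in>S. 0 \<le> l v" "\<exists>v\<in>S. 0 < l v" "\<forall>u\<in>M. (\<Sum>v\<in>S. l v * f v u) = 0"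
      using insert.IH[OF insert.prems] by blast
    then show ?thesis by (intro dependent[of l 0]) auto
  next
    case True
    then obtain u0 where u0: "u0 \<in> M" "\<forall>v\<in>S. 0 < f v u0" by blast
    show ?thesis
    proof (cases "\<forall>u\<in>M. f w u = 0")
      case True
      then show ?thesis by (intro dependent[of "\<lambda>_. 0" 1]) auto
    next
      case False
      then obtain y0 where "y0 \<in> M" "f w y0 \<noteq> 0" by blast
      \<comment> \<open>The normalisation \<open>f w y = 1\<close> makes
        \<open>u - f w u *\<^sub>R y\<close> a projection of \<open>M\<close> onto the kernel of
        \<open>f w\<close>.\<close>
      define y where "y = inverse (f w y0) *\<^sub>R y0"
      have y: "y \<in> M" "f w y = 1"
        using \<open>y0 \<in> M\<close> \<open>f w y0 \<noteq> 0\<close> insert.prems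
        by (simp_all add: y_def subspace_scale linear_scale[OF lin])
      have "subspace {u \<in> M. f w u = 0}"
        using insert.prems by (auto simp: subspace_def linear_add[OF lin] linear_scale[OF lin] linear_0[OF lin])
      from insert.IH[OF this] show ?thesis
      proof (elim disjE exE conjE bexE)
        fix u assume u: "u \<in> {u \<in> M. f w u = 0}" "\<forall>v\<in>S. 0 < f v u"
        \<comment> \<open>A solution inside the kernel is tilted towards \<open>y\<close> to make
          \<open>f w\<close> positive as well.\<close>
        obtain t where "t < 1" and t: "0 < t" "\<forall>v\<in>S. 0 < f v (u + t *\<^sub>R y)"
          by (rule positive_perturbation[OF insert(1) lin u(2)])
        have "u + t *\<^sub>R y \<in> M"
          using u y insert.prems by (auto intro: subspace_add subspace_scale)
        moreover have "0 < f w (u + t *\<^sub>R y)"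
          using u t y by (simp add: linear_add[OF lin] linear_scale[OF lin])
        ultimately show ?thesis using t by (intro disjI1 bexI[of _ "u + t *\<^sub>R y"]) auto
      next
        fix l v0
        assume l: "\<forall>v\<in>S. 0 \<le> l v" "v0 \<in> S" "0 < l v0"
          "\<forall>u\<in>{u \<in> M. f w u = 0}. (\<Sum>v\<in>S. l v * f v u) = 0"
        \<comment> \<open>The combination vanishes on the kernel of \<open>f w\<close>, so on
          \<open>M\<close> it equals \<open>c\<close> times \<open>f w\<close>. Its value at
          \<open>u0\<close> is positive: either \<open>u0\<close> already makes \<open>f w\<close>
          positive, or \<open>c < 0\<close> and \<open>- c\<close> is the coefficient of
          \<open>w\<close> in a nonnegative relation.\<close>
        define c where "c = (\<Sum>v\<in>S. l v * f v y)"
        have c: "(\<Sum>v\<in>S. l v * f v u) = c * f w u" if "u \<in> M" for u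
        proof -
          have "u - f w u *\<^sub>R y \<in> {u \<in> M. f w u = 0}"
            using that y insert.prems
            by (auto simp: linear_diff[OF lin] linear_scale[OF lin] intro: subspace_diff subspace_scale)
          then have "(\<Sum>v\<in>S. l v * f v (u - f w u *\<^sub>R y)) = 0" using l(4) by blast
          then show ?thesis
            by (simp add: c_def linear_diff[OF lin] linear_scale[OF lin] right_diff_distrib
                sum_subtractf sum_distrib_left sum_distrib_right algebra_simps)
        qed
        have "0 < (\<Sum>v\<in>S. l v * f v u0)"
          using l u0 by (intro sum_pos2[OF insert(1) l(2)]) (auto intro: mult_nonneg_nonneg less_imp_le)
        then have "0 < c * f w u0" using c[OF u0(1)] by simp
        then consider "0 < f w u0" | "c < 0" by (auto simp: zero_less_mult_iff)
        then show ?thesis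
        proof cases
          case 1
          then show ?thesis using u0 by (intro disjI1 bexI[of _ u0]) auto
        next
          case 2
          then show ?thesis using l c by (intro dependent[of l "- c"]) auto
        qed
      qed
    qed
  qed
qed

section \<open>The simplex in barycentric coordinates\<close>

lemma lookup_sum_basis_vec:
  assumes "finite S"
  shows "Poly_Mapping.lookup (\<Sum>v\<in>S. t v *\<^sub>R basis_vec v) i = (if i \<in> S then t i else 0)"
proof -
  have "(\<Sum>v\<in>S. t v * (1 when v = i)) = (\<Sum>v\<in>S. if v = i then t i else 0)"
    by (intro sum.cong) (auto simp: when_def)
  then show ?thesis using assms by (simp add: lookup_sum basis_vec_def lookup_single)
qed

lemma sum_lookup_basis_vec:
  assumes "finite S" "x \<in> coord_space S"
  shows "(\<Sum>v\<in>S. Poly_Mapping.lookup x v *\<^sub>R basis_vec v) = x"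
  using assms by (intro poly_mapping_eqI) (simp add: lookup_sum_basis_vec mem_coord_space_iff)

lemma simplex_hull_eq:
  assumes "finite S"
  shows "simplex_hull S = {x \<in> coord_space S. (\<forall>v\<in>S. 0 \<le> Poly_Mapping.lookup x v)
    \<and> (\<Sum>v\<in>S. Poly_Mapping.lookup x v) = 1}" (is "_ = ?R")
proof
  have "convex ?R"
    unfolding convex_def
    by (auto simp: coord_space_add_scaleR lookup_add sum.distrib simp flip: sum_distrib_left)
  moreover have "basis_vec ` S \<subseteq> ?R"
    using assms by (auto simp: basis_vec_in_coord_space) 
      (auto simp: basis_vec_def lookup_single when_def)
  ultimately show "simplex_hull S \<subseteq> ?R" unfolding simplex_hull_def by (rule hull_minimal[rotated])
next
  show "?R \<subseteq> simplex_hull S"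
  proof
    fix x assume x: "x \<in> ?R"
    have "(\<Sum>v\<in>S. Poly_Mapping.lookup x v *\<^sub>R basis_vec v) \<in> simplex_hull S"
      unfolding simplex_hull_def using x assms
      by (intro convex_sum convex_convex_hull) (auto intro: hull_inc)
    then show "x \<in> simplex_hull S" using sum_lookup_basis_vec[OF assms, of x] x by simp
  qed
qed

lemma dist_lookup_le: "dist (Poly_Mapping.lookup x i) (Poly_Mapping.lookup y i) \<le> dist x y"
  for x y :: "'a \<Rightarrow>\<^sub>0 'b::real_normed_vector"
proof (cases "i \<in> keys x \<union> keys y")
  case True
  then show ?thesis unfolding dist_poly_mapping_def
    by (intro member_le_sum[where f = "\<lambda>n. dist (Poly_Mapping.lookup x n) (Poly_Mapping.lookup y n)"]) auto
next
  case False
  then show ?thesis by (simp add: in_keys_iff)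
qed

lemma open_lookup_pos: "open {x :: 'a \<Rightarrow>\<^sub>0 real. 0 < Poly_Mapping.lookup x i}"
  unfolding open_dist
proof (intro ballI)
  fix x :: "'a \<Rightarrow>\<^sub>0 real" assume "x \<in> {x. 0 < Poly_Mapping.lookup x i}"
  moreover have "0 < Poly_Mapping.lookup y i" if "dist y x < Poly_Mapping.lookup x i" for y
    using dist_lookup_le[of y i x] that by (simp add: dist_real_def)
  ultimately show "\<exists>e>0. \<forall>y. dist y x < e \<longrightarrow> y \<in> {x. 0 < Poly_Mapping.lookup x i}"
    by blast
qed

text \<open>On the affine hull the coordinates sum to 1, so positivity of the coordinates, an open
  condition, cuts out a relatively open set inside the simplex that contains the point.\<close>

lemma sum_basis_vec_in_open_simplex:
  fixes S :: "'a set"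
  assumes "finite S" "\<And>v. v \<in> S \<Longrightarrow> 0 < t v" "sum t S = 1"
  shows "(\<Sum>v\<in>S. t v *\<^sub>R basis_vec v) \<in> open_simplex S"
proof -
  let ?x = "\<Sum>v\<in>S. t v *\<^sub>R basis_vec v"
  let ?H = "affine hull simplex_hull S" and ?P = "\<Inter>v\<in>S. {x :: 'a \<Rightarrow>\<^sub>0 real. 0 < Poly_Mapping.lookup x v}"
  have x: "?x \<in> simplex_hull S" "?x \<in> ?P"
    using assms unfolding simplex_hull_eq[OF assms(1)]
    by (auto simp: lookup_sum_basis_vec mem_coord_space_iff less_imp_le)
  have "open ?P" using assms(1) by (intro open_INT) (auto simp: open_lookup_pos)
  then have "openin (top_of_set ?H) (?H \<inter> ?P)" by (rule openin_open_Int)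
  moreover have "?x \<in> ?H \<inter> ?P" using x by (auto intro: hull_inc)
  moreover have "?H \<inter> ?P \<subseteq> simplex_hull S"
  proof
    fix y assume y: "y \<in> ?H \<inter> ?P"
    have "affine {x \<in> coord_space S. (\<Sum>v\<in>S. Poly_Mapping.lookup x v) = 1}"
      unfolding affine_def
      by (auto simp: coord_space_add_scaleR lookup_add sum.distrib simp flip: sum_distrib_left)
    then have "?H \<subseteq> {x \<in> coord_space S. (\<Sum>v\<in>S. Poly_Mapping.lookup x v) = 1}"
      using simplex_hull_eq[OF assms(1)] by (intro hull_minimal) auto
    then show "y \<in> simplex_hull S"
      using y unfolding simplex_hull_eq[OF assms(1)] by (auto intro: less_imp_le)
  qed
  ultimately show ?thesis unfolding open_simplex_def rel_interior_def by blast
qed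

lemma open_simplex_subset: "open_simplex S \<subseteq> simplex_hull S"
  unfolding open_simplex_def rel_interior_def by blast

section \<open>Half-spaces and faces that capture the origin\<close>

definition coord_inner :: "nat \<Rightarrow> (nat \<Rightarrow>\<^sub>0 real) \<Rightarrow> (nat \<Rightarrow>\<^sub>0 real) \<Rightarrow> real" where
  "coord_inner d x u = (\<Sum>i<d. Poly_Mapping.lookup x i * Poly_Mapping.lookup u i)"

lemma linear_coord_inner: "linear (coord_inner d x)"
  by (rule linearI) (simp_all add: coord_inner_def lookup_add distrib_left sum.distrib sum_distrib_left
      mult.left_commute)

lemma coord_inner_commute: "coord_inner d x u = coord_inner d u x"
  by (simp add: coord_inner_def mult.commute)

lemma coord_inner_basis_vec: "i < d \<Longrightarrow> coord_inner d x (basis_vec i) = Poly_Mapping.lookup x i"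
proof -
  assume "i < d"
  have "coord_inner d x (basis_vec i) = (\<Sum>j<d. if j = i then Poly_Mapping.lookup x i else 0)"
    unfolding coord_inner_def basis_vec_def by (intro sum.cong) (auto simp: lookup_single)
  then show ?thesis using \<open>i < d\<close> by simp
qed

lemma subspace_coord_space: "subspace (coord_space S :: ('a \<Rightarrow>\<^sub>0 real) set)"
  by (simp add: subspace_def mem_coord_space_iff lookup_add)

lemma basis_vec_in_realization:
  assumes "finite V" "v \<in> V"
  shows "basis_vec v \<in> realization (Pow V)"
proof -
  have "(\<Sum>w\<in>{v}. 1 *\<^sub>R basis_vec w) \<in> open_simplex {v}"
    by (rule sum_basis_vec_in_open_simplex) auto
  then show ?thesis using assms(2) unfolding realization_def by auto
qed

lemma affine_map_basis_vec:
  assumes "affine_map (Pow V) d A" "finite V" "v \<in> V"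
  shows "A (basis_vec v) \<in> coord_space {..<d}"
  using assms basis_vec_in_realization[OF assms(2,3)] unfolding affine_map_def by blast

lemma affine_map_sum:
  assumes "affine_map (Pow V) d A" "S \<subseteq> V" "\<And>v. v \<in> S \<Longrightarrow> 0 \<le> t v" "sum t S = 1"
  shows "A (\<Sum>v\<in>S. t v *\<^sub>R basis_vec v) = (\<Sum>v\<in>S. t v *\<^sub>R A (basis_vec v))"
  using assms unfolding affine_map_def by simp

text \<open>A convex combination of the numbers \<open>coord_inner d (A (basis_vec v)) u\<close> is
  zero, so they cannot all be negative. The inequality is weak, as all image points may lie in the
  hyperplane orthogonal to \<open>u\<close>; the blow-up repairs this.\<close>

lemma face_image_half_space:
  assumes A: "affine_map (Pow V) d A" and "finite V" "S \<subseteq> V" "0 \<in> face_image A S"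
  obtains v where "v \<in> S" "0 \<le> coord_inner d (A (basis_vec v)) u"
proof -
  have fin: "finite S" using assms finite_subset by blast
  obtain x where x: "x \<in> simplex_hull S" "A x = 0"
    using assms(4) open_simplex_subset[of S] unfolding face_image_def by auto
  define t where "t = Poly_Mapping.lookup x"
  have t: "x \<in> coord_space S" "\<And>v. v \<in> S \<Longrightarrow> 0 \<le> t v" "sum t S = 1"
    using x(1) unfolding simplex_hull_eq[OF fin] t_def by auto
  have "(\<Sum>v\<in>S. t v *\<^sub>R A (basis_vec v)) = 0"
    using affine_map_sum[OF A \<open>S \<subseteq> V\<close> t(2,3)] sum_lookup_basis_vec[OF fin t(1)] x(2)
    unfolding t_def by simp
  then have "coord_inner d u (\<Sum>v\<in>S. t v *\<^sub>R A (basis_vec v)) = 0"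
    by (simp add: linear_0[OF linear_coord_inner])
  then have zero: "(\<Sum>v\<in>S. t v * coord_inner d (A (basis_vec v)) u) = 0"
    by (simp add: linear_sum[OF linear_coord_inner] linear_scale[OF linear_coord_inner]
        coord_inner_commute)
  have "\<exists>v\<in>S. 0 \<le> coord_inner d (A (basis_vec v)) u"
  proof (rule ccontr)
    assume "\<not> (\<exists>v\<in>S. 0 \<le> coord_inner d (A (basis_vec v)) u)"
    then have neg: "coord_inner d (A (basis_vec v)) u < 0" if "v \<in> S" for v using that by force
    have "\<exists>v\<in>S. 0 < t v"
    proof (rule ccontr)
      assume "\<not> (\<exists>v\<in>S. 0 < t v)"
      then have "sum t S = 0" using t(2) by (intro sum.neutral) force
      then show False using t(3) by simp
    qed
    then obtain v where v: "v \<in> S" "0 < t v" by blast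
    have "0 < (\<Sum>v\<in>S. t v * (- coord_inner d (A (basis_vec v)) u))"
      using v neg t(2) by (intro sum_pos2[OF fin v(1)])
        (auto simp: mult_less_0_iff intro: mult_nonneg_nonpos less_imp_le)
    then show False using zero by (simp add: sum_negf)
  qed
  then show ?thesis using that by blast
qed

text \<open>The alternative to a common half-space is a nonnegative relation among the image points.
  Rescaled on its support \<open>S'\<close>, it puts 0 in the image of the open simplex on
  \<open>S'\<close>; hence \<open>none\<close> ranges over all subfaces.\<close>

lemma face_image_alternative:
  assumes A: "affine_map (Pow V) d A" and "finite V" "S \<subseteq> V"
    and none: "\<And>S'. S' \<subseteq> S \<Longrightarrow> 0 \<notin> face_image A S'"
  shows "\<exists>u\<in>coord_space {..<d}. \<forall>v\<in>S. 0 < coord_inner d (A (basis_vec v)) u"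
proof (rule ccontr)
  assume "\<not> ?thesis"
  moreover have fin: "finite S" using assms finite_subset by blast
  ultimately obtain l v0 where l: "\<forall>v\<in>S. 0 \<le> l v" "v0 \<in> S" "0 < l v0"
      "\<forall>u\<in>coord_space {..<d}. (\<Sum>v\<in>S. l v * coord_inner d (A (basis_vec v)) u) = 0"
    using linear_alternative[of S "\<lambda>v. coord_inner d (A (basis_vec v))" "coord_space {..<d}",
        OF fin linear_coord_inner subspace_coord_space] by blast
  define S' where "S' = {v \<in> S. 0 < l v}"
  define m where "m = sum l S'"
  have S': "S' \<subseteq> S" "finite S'" "v0 \<in> S'" using fin l unfolding S'_def by auto
  have "0 < m" unfolding m_def using S' by (intro sum_pos2[OF S'(2,3)]) (auto simp: S'_def)
  define t where "t v = l v / m" for v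
  have t: "\<And>v. v \<in> S' \<Longrightarrow> 0 < t v" "sum t S' = 1"
    using \<open>0 < m\<close> by (auto simp: t_def S'_def m_def simp flip: sum_divide_distrib)
  \<comment> \<open>The relation is known only after pairing with directions. Basis vectors read off
    the coordinates below \<open>d\<close>, and the others vanish because the image points lie in
    \<open>coord_space {..<d}\<close>.\<close>
  have "(\<Sum>v\<in>S'. l v *\<^sub>R A (basis_vec v)) = 0"
  proof (rule poly_mapping_eqI)
    fix i
    have "(\<Sum>v\<in>S'. l v * Poly_Mapping.lookup (A (basis_vec v)) i)
        = (\<Sum>v\<in>S. l v * Poly_Mapping.lookup (A (basis_vec v)) i)"
      using fin l(1) by (intro sum.mono_neutral_left) (auto simp: S'_def less_le)
    also have "\<dots> = 0"
    proof (cases "i < d")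
      case True
      then have "(\<Sum>v\<in>S. l v * coord_inner d (A (basis_vec v)) (basis_vec i)) = 0"
        using l(4) basis_vec_in_coord_space[of i "{..<d}"] by auto
      then show ?thesis by (simp add: coord_inner_basis_vec True)
    next
      case False
      then have "Poly_Mapping.lookup (A (basis_vec v)) i = 0" if "v \<in> S" for v
        using affine_map_basis_vec[OF A \<open>finite V\<close>, of v] that \<open>S \<subseteq> V\<close>
        by (auto simp: mem_coord_space_iff)
      then show ?thesis by simp
    qed
    finally show "Poly_Mapping.lookup (\<Sum>v\<in>S'. l v *\<^sub>R A (basis_vec v)) i = Poly_Mapping.lookup 0 i"
      by (simp add: lookup_sum)
  qed
  then have "(1 / m) *\<^sub>R (\<Sum>v\<in>S'. l v *\<^sub>R A (basis_vec v)) = 0" by simp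
  then have "(\<Sum>v\<in>S'. t v *\<^sub>R A (basis_vec v)) = 0"
    by (simp add: scaleR_sum_right t_def)
  then have "A (\<Sum>v\<in>S'. t v *\<^sub>R basis_vec v) = 0"
    using affine_map_sum[OF A, of S' t] t S' \<open>S \<subseteq> V\<close> by (auto simp: less_imp_le)
  moreover have "(\<Sum>v\<in>S'. t v *\<^sub>R basis_vec v) \<in> open_simplex S'"
    using sum_basis_vec_in_open_simplex[OF S'(2) t] .
  ultimately have "0 \<in> face_image A S'" unfolding face_image_def by force
  then show False using none S' by blast
qed

section \<open>Clusters around the points and the final contradiction\<close>

lemma color_join_subset:
  assumes "\<sigma> \<in> color_join V m n" "disjoint_family_on V {m..n}"
  shows "\<sigma> \<subseteq> (\<Union>i\<in>{m..n}. V i)"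
  using mem_list_join_iff[of "[m..<Suc n]" V \<sigma>] assms
  unfolding color_join_eq_list_join by (simp add: atLeastLessThanSuc_atLeastAtMost del: upt_Suc)

theorem theorem12:
  fixes d k :: nat
    and V :: "nat \<Rightarrow> 'a set"
    and T :: "'a set set"
    and A :: "('a \<Rightarrow>\<^sub>0 real) \<Rightarrow> (nat \<Rightarrow>\<^sub>0 real)"
  assumes "k \<le> d"
    and "\<And>i. i \<in> {1..d+1} \<Longrightarrow> finite (V i)"
    and "disjoint_family_on V {1..d+1}"
    and "spanning_tree_Z2 k (color_join V 1 (k+1)) T"
    and "colorful_caratheodory_map d V A"
  shows "\<exists>\<sigma> \<in> complex_join T (color_join V (k+2) (d+1)). 0 \<in> face_image A \<sigma>"
proof (rule ccontr)
  define W where "W = (\<Union>i\<in>{1..d+1}. V i)"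
  define Q where "Q = complex_join T (color_join V (k+2) (d+1))"
  assume "\<not> (\<exists>\<sigma> \<in> complex_join T (color_join V (k+2) (d+1)). 0 \<in> face_image A \<sigma>)"
  then have none: "0 \<notin> face_image A \<sigma>" if "\<sigma> \<in> Q" for \<sigma> using that unfolding Q_def by blast
  have W: "finite W" "\<And>i. i \<in> {1..d+1} \<Longrightarrow> V i \<subseteq> W"
    using assms(2) unfolding W_def by blast+
  have A: "affine_map (Pow W) d A" "\<And>i. i \<in> {1..d+1} \<Longrightarrow> 0 \<in> face_image A (V i)"
    using assms(5) unfolding colorful_caratheodory_map_def W_def by auto
  have nonneg: "\<exists>v\<in>V i. 0 \<le> coord_inner d (A (basis_vec v)) u" if "i \<in> {1..d+1}" for i u
    using face_image_half_space[OF A(1) W(1,2) A(2), OF that that] by blast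
  have T: "simplicial_complex T" "T \<subseteq> color_join V 1 (k+1)"
      "\<And>\<sigma>. \<sigma> \<in> color_join V 1 (k+1) \<Longrightarrow> face_dim \<sigma> \<le> int k - 1 \<Longrightarrow> \<sigma> \<in> T"
    using assms(4) unfolding spanning_tree_Z2_def by auto
  have Q: "simplicial_complex Q"
    unfolding Q_def color_join_eq_list_join
    by (intro simplicial_complex_join simplicial_complex_list_join T)
  have disj: "disjoint_family_on V {m..n}" if "1 \<le> m" "n \<le> d + 1" for m n
    using that by (intro disjoint_family_on_mono[OF _ assms(3)]) auto
  have QW: "\<sigma> \<subseteq> W" if \<sigma>: "\<sigma> \<in> Q" for \<sigma>
  proof -
    obtain a b where ab: "a \<in> T" "b \<in> color_join V (k+2) (d+1)" "\<sigma> = a \<union> b"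
      using \<sigma> unfolding Q_def complex_join_def by blast
    have "a \<subseteq> (\<Union>i\<in>{1..k+1}. V i)" "b \<subseteq> (\<Union>i\<in>{k+2..d+1}. V i)"
      using ab(1,2) T(2) \<open>k \<le> d\<close> by (intro color_join_subset disj; auto)+
    moreover have "(\<Union>i\<in>{1..k+1}. V i) \<subseteq> W" "(\<Union>i\<in>{k+2..d+1}. V i) \<subseteq> W"
      unfolding W_def using \<open>k \<le> d\<close> by (intro UN_mono; auto)+
    ultimately show ?thesis using ab(3) by blast
  qed
  have "finite Q" using QW W(1) by (meson Pow_iff finite_Pow_iff finite_subset subsetI)
  have "\<exists>u\<in>coord_space {..<d}. \<forall>v\<in>\<sigma>. 0 < coord_inner d (A (basis_vec v)) u" if "\<sigma> \<in> Q" for \<sigma>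
    using face_image_alternative[OF A(1) W(1) QW[OF that]] none simplicial_complexD(3)[OF Q that]
    by blast
  \<comment> \<open>One direction is fixed for each face before the size of the clusters is
    chosen.\<close>
  then obtain U where U: "\<And>\<sigma>. \<sigma> \<in> Q \<Longrightarrow> U \<sigma> \<in> coord_space {..<d}"
      "\<And>\<sigma> v. \<sigma> \<in> Q \<Longrightarrow> v \<in> \<sigma> \<Longrightarrow> 0 < coord_inner d (A (basis_vec v)) (U \<sigma>)"
    by metis

  \<comment> \<open>Displacements within a cluster: the centre and both signs of every basis vector,
    so that every nonzero direction is positive on some displacement. The centre keeps
    \<open>J\<close> nonempty also when \<open>d = 0\<close>.\<close>
  define J :: "(nat \<Rightarrow>\<^sub>0 real) set"
    where "J = insert 0 ((\<lambda>(s, i). s *\<^sub>R basis_vec i) ` ({1, -1} \<times> {..<d}))"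
  have J: "finite J" "0 \<in> J" by (auto simp: J_def)
  \<comment> \<open>The vertex \<open>(v, e)\<close> of the blow-up sits at
    \<open>A (basis_vec v) + \<epsilon> *\<^sub>R e\<close>.\<close>
  define f where "f \<epsilon> p u = coord_inner d (A (basis_vec (fst p))) u + \<epsilon> * coord_inner d (snd p) u"
    for \<epsilon> :: real and p :: "'a \<times> (nat \<Rightarrow>\<^sub>0 real)" and u
  \<comment> \<open>Finitely many strict inequalities hold at \<open>\<epsilon> = 0\<close>, hence
    for all small positive \<open>\<epsilon>\<close>: the clusters over a face of \<open>Q\<close>
    stay in the half-space of its direction.\<close>
  have "\<forall>\<^sub>F \<epsilon> in at_right 0. \<forall>\<sigma>\<in>Q. \<forall>v\<in>\<sigma>. \<forall>e\<in>J. 0 < f \<epsilon> (v, e) (U \<sigma>)"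
  proof (intro eventually_ball_finite ballI J \<open>finite Q\<close>)
    fix \<sigma> v e assume "\<sigma> \<in> Q" "v \<in> \<sigma>"
    have "((\<lambda>\<epsilon>. f \<epsilon> (v, e) (U \<sigma>)) \<longlongrightarrow> f 0 (v, e) (U \<sigma>)) (at_right 0)"
      unfolding f_def by (intro tendsto_intros)
    then show "\<forall>\<^sub>F \<epsilon> in at_right 0. 0 < f \<epsilon> (v, e) (U \<sigma>)"
      using U(2)[OF \<open>\<sigma> \<in> Q\<close> \<open>v \<in> \<sigma>\<close>] by (intro order_tendstoD(1)) (auto simp: f_def)
  qed (use simplicial_complexD(2)[OF Q] in blast)
  then have "\<forall>\<^sub>F \<epsilon> in at_right 0. (\<forall>\<sigma>\<in>Q. \<forall>v\<in>\<sigma>. \<forall>e\<in>J. 0 < f \<epsilon> (v, e) (U \<sigma>)) \<and> 0 < \<epsilon>"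
    using eventually_at_right_less[of "0::real"] by (rule eventually_conj)
  then obtain \<epsilon> where \<epsilon>: "\<forall>\<sigma>\<in>Q. \<forall>v\<in>\<sigma>. \<forall>e\<in>J. 0 < f \<epsilon> (v, e) (U \<sigma>)" "0 < \<epsilon>"
    using eventually_happens'[OF trivial_limit_at_right_real] by blast

  let ?V = "\<lambda>i. V i \<times> J" and ?T = "{\<sigma> \<in> color_join (\<lambda>i. V i \<times> J) 1 (k+1). fst ` \<sigma> \<in> T}"
  have V: "finite (V i) \<and> V i \<noteq> {}" if "i \<in> {1..d+1}" for i
    using assms(2) nonneg that by blast
  have "\<exists>\<tau>\<in>complex_join ?T (color_join ?V (k+2) (d+1)).
      \<forall>u\<in>coord_space {..<d}. \<exists>p\<in>\<tau>. f \<epsilon> p u \<le> 0"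
  proof (rule colorful_half_spaces[OF \<open>k \<le> d\<close>])
    show "linear (f \<epsilon> p)" for p
      by (rule linearI) (simp_all add: f_def linear_add[OF linear_coord_inner]
          linear_scale[OF linear_coord_inner] algebra_simps)
    show "finite (?V i) \<and> ?V i \<noteq> {}" if "i \<in> {1..d+1}" for i using V[OF that] J by auto
    show "disjoint_family_on ?V {1..d+1}" using assms(3) by (auto simp: disjoint_family_on_def)
    show "\<exists>p\<in>?V i. 0 < f \<epsilon> p u" if i: "i \<in> {1..d+1}" and u: "u \<in> coord_space {..<d} - {0}" for i u
    proof -
      obtain v where v: "v \<in> V i" "0 \<le> coord_inner d (A (basis_vec v)) u" using nonneg i by blast
      have "\<exists>j. Poly_Mapping.lookup u j \<noteq> 0" using u by (metis DiffE lookup_zero poly_mapping_eqI singletonI)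
      then obtain j where j: "Poly_Mapping.lookup u j \<noteq> 0" by blast
      then have "j < d" using u by (auto simp: mem_coord_space_iff)
      \<comment> \<open>The vertex \<open>v\<close> gives a weak inequality; a displacement along
        the \<open>j\<close>-th axis with the sign of that coordinate of \<open>u\<close> makes it
        strict.\<close>
      define s where "s = sgn (Poly_Mapping.lookup u j)"
      have "s \<in> {1, -1}" using j by (auto simp: s_def sgn_if)
      then have "s *\<^sub>R basis_vec j \<in> J" unfolding J_def using \<open>j < d\<close> by force
      moreover have "coord_inner d (s *\<^sub>R basis_vec j) u = s * Poly_Mapping.lookup u j"
        unfolding coord_inner_commute[of d _ u] linear_scale[OF linear_coord_inner]
          coord_inner_basis_vec[OF \<open>j < d\<close>] by simp
      then have "0 < coord_inner d (s *\<^sub>R basis_vec j) u" using j by (simp add: s_def sgn_if)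
      then have "0 < f \<epsilon> (v, s *\<^sub>R basis_vec j) u"
        using v(2) \<open>0 < \<epsilon>\<close> by (simp add: f_def add_nonneg_pos)
      ultimately show ?thesis using v(1) by blast
    qed
    show "simplicial_complex ?T"
      unfolding color_join_eq_list_join
      by (intro simplicial_complex_preimage simplicial_complex_list_join T)
    show "\<sigma> \<in> ?T" if \<sigma>: "\<sigma> \<in> color_join ?V 1 (k+1)" "face_dim \<sigma> \<le> int k - 1" for \<sigma>
    proof -
      have "finite \<sigma>"
        using \<sigma>(1) simplicial_complexD(2)[OF simplicial_complex_list_join]
        unfolding color_join_eq_list_join by blast
      then have "face_dim (fst ` \<sigma>) \<le> int k - 1"
        using \<sigma>(2) card_image_le[of \<sigma> fst] by (simp add: face_dim_def)
      moreover have "fst ` \<sigma> \<in> color_join V 1 (k+1)"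
        using \<sigma>(1) unfolding color_join_eq_list_join by (rule fst_image_list_join)
      ultimately show ?thesis using \<sigma>(1) T(3) by blast
    qed
    show "acyclic_Z2 (int k - 1) ?T"
      using V \<open>k \<le> d\<close> by (intro acyclic_blowup[OF _ disj J assms(4)]) auto
  qed auto
  then obtain a b where ab: "a \<in> ?T" "b \<in> color_join ?V (k+2) (d+1)"
      "\<forall>u\<in>coord_space {..<d}. \<exists>p\<in>a \<union> b. f \<epsilon> p u \<le> 0"
    unfolding complex_join_def by blast
  have "fst ` b \<in> color_join V (k+2) (d+1)"
    using ab(2) unfolding color_join_eq_list_join by (rule fst_image_list_join)
  moreover have "fst ` a \<in> T" using ab(1) by simp
  \<comment> \<open>Forgetting the displacements returns a face of \<open>Q\<close>, whose direction
    is positive on the whole cluster over each of its vertices; this contradicts the choice of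
    \<open>a\<close> and \<open>b\<close>.\<close>
  ultimately have mem: "fst ` (a \<union> b) \<in> Q"
    unfolding Q_def complex_join_def image_Un by blast
  have disj': "disjoint_family_on ?V {m..n}" if "1 \<le> m" "n \<le> d + 1" for m n
    using disj[OF that] by (auto simp: disjoint_family_on_def)
  have "a \<subseteq> (\<Union>i\<in>{1..k+1}. ?V i)" "b \<subseteq> (\<Union>i\<in>{k+2..d+1}. ?V i)"
    using ab(1,2) \<open>k \<le> d\<close> by (intro color_join_subset disj'; simp)+
  then have "snd p \<in> J" if "p \<in> a \<union> b" for p using that by auto
  then have "0 < f \<epsilon> p (U (fst ` (a \<union> b)))" if "p \<in> a \<union> b" for p
    using \<epsilon>(1) mem that by (metis imageI prod.collapse)
  then show False using ab(3) U(1)[OF mem] by (meson not_le)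
qed

end
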